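(* Consider the bilevel problem $\min_{x\in C}f(x):=E(w(x),x)$ subject to $w(x)=\Phi(w(x),x)$ in the setting described in the context, with $C$ of diameter $\Delta>0$, contraction constants $q_x$ and $q=\max_{x\in C}q_x<1$, and uniform hypergradient error constant $M$. Let $\sigma\in[0,1/3)$, $\tau>0$ and $\rho>0$. Solve the problem by one of the three inexact Frank-Wolfe algorithms described in the context (vanilla; away-step, with $C$ a polytope; pairwise with controlled swaps and parameter $R\in\mathbb{N}$, with $C$ a polytope) with tolerance $\tau$ and with step sizes satisfying $$\eta_n\ge\bar\eta_n:=\min\Bigl\{\eta_n^{\max},\frac{\tilde g_n}{L\|d_n\|^2}\Bigr\},\qquad f(x_n)-f(x_n+\eta_nd_n)\ge\rho\,\bar\eta_n\,\tilde g_n ,$$ where the gradient estimates $\widetilde\nabla f(x_n)$ are computed either by ITD with $t=T$ iterations, where $$T=\left\lceil\frac1{1-\varepsilon}\log_q\!\left(\frac{\sigma\tau}{(1+\sigma)\Delta M}\cdot\frac{\varepsilon q\log q^{-1}}{1+2\varepsilon q\log q^{-1}}\right)\right\rceil$$ for any $\varepsilon\in(0,1)$, or by AID with $k=t=T$ iterations, where $$T=\left\lceil\log_q\!\left(\frac{\sigma\tau}{(1+\sigma)\Delta M}\cdot\frac{1-q}{3-2q}\right)\right\rceil .$$ Put $$\bar N=\lceil\kappa\max\{\alpha_1,\alpha_2\}\rceil-1,\qquad \alpha_1=\frac{\Delta^2L\,(f(x_0)-f^* )(1+\sigma)^2}{\tau^2\rho(1-\sigma)^2},\qquad \alpha_2=\frac{2\,(f(x_0)-f^*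 )(1+\sigma)}{\tau(1-3\sigma)},$$ where $\kappa=1$ for the vanilla, $\kappa=2$ for the away-step and $\kappa=2(R+1)$ for the pairwise algorithm. Then the algorithm terminates after a finite number of (upper-level) iterations, specifically in at most $\bar N$ iterations, and the total number of (upper and lower) iterations is bounded by $\bar N\times T$. The best Frank-Wolfe gap satisfies $g_N^*\le\tau/(1+\sigma)$. Asymptotically (as $\tau\to0^+$), the iteration complexity is of the order $\mathcal{O}(\tau^{-2}\log(\tau^{-1}))$.
   Context: Setting. $C\subset\mathbb{R}^d$ is nonempty, compact and convex; $E\colon\mathbb{R}^d\times C\to\mathbb{R}$ and $\Phi\colon\mathbb{R}^d\times C\to\mathbb{R}^d$ are continuously differentiable functions of $(w,x)$. For each $x$, $\Phi(\cdot,x)$ is a contraction with constant $q_x\in(0,1)$, so $w(x)$ is its unique fixed point; $\Phi$, $E$ and their derivatives are Lipschitz continuous; $q=\max_{x\in C}q_x<1$. The function $f(x)=E(w(x),x)$ (regarded as a function on $\mathbb{R}^d$) is differentiable with $L$-Lipschitz continuous gradient, and $f^*=\min_{x\in C}f(x)$. Here $\partial_1,\partial_2$ (resp. $\nabla_1,\nabla_2$) denote partial Jacobians (resp. gradients) in the first and second argument. ITD with $t$ iterations: $w_0(x)=0$, $w_i(x)=\Phi(w_{i-1}(x),x)$ for $i=1,\dots,t$, and $\widetilde\nabla f(x)=\nabla f_t(x)$ with $f_t(x)=E(w_t(x),x)$, computed by automatic differentiation. AID (with fixed point method) with $t$ and $k$ iterations: $w_t(x)$ as in ITD, $u_{t,0}(x)=0$,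 $u_{t,j}(x)=\partial_1\Phi(w_t(x),x)^\top u_{t,j-1}(x)+\nabla_1E(w_t(x),x)$ for $j=1,\dots,k$, and $\widetilde\nabla f(x)=\nabla_2E(w_t(x),x)+\partial_2\Phi(w_t(x),x)^\top u_{t,k}(x)$. Known hypergradient error guarantees (Grazzi et al., 2020): there are quantities $c_1(x),c_2(x),c_3(x)$, uniformly bounded on $C$ by a constant $M$ (depending on the Lipschitz constants of $\Phi$, $E$ and their derivatives and on $\Delta$), such that for all $x\in C$ $$\|\widetilde\nabla f(x)-\nabla f(x)\|\le(c_1(x)+c_3(x))q_x^t+c_2(x)\,t\,q_x^{t-1}\quad\text{(ITD)},$$ $$\|\widetilde\nabla f(x)-\nabla f(x)\|\le\Bigl(c_1(x)+\frac{c_2(x)}{1-q_x}\Bigr)q_x^t+c_3(x)q_x^k\quad\text{(AID)}.$$ The values of $T$ in the claim are chosen so that $|(\nabla f(\bar x)-\widetilde\nabla f(\bar x))^\top(x-\bar x)|\le\frac{\sigma}{1+\sigma}\tau$ for all $x,\bar x\in C$. Vanilla inexact Frank-Wolfe algorithm. From $x_0\in C$, for $n=0,1,\dots$: $\hat x_n\in\arg\min_{x\in C}\widetilde\nabla f(x_n)^\top(x-x_n)$, $d_n=\hat x_n-x_n$, $\eta_n^{\max}=1$, choose $\eta_n\in(0,1]$ by a line search, $x_{n+1}=x_n+\eta_nd_n$; stop after this iteration if $-\widetilde\nabla f(x_n)^\top d_n\le\tau$. Inexact away-step Frank-Wolfe algorithm. $C=\mathrm{conv}\{a_0,\dots,a_p\}$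 is a polytope. Iterates are kept as $x_n=\sum_jw_n^ja_j$ (convex combination) with $S_n=\{j:w_n^j>0\}$; $x_0=a_{i_0}$, with weight $1$ on $i_0$. For $n=0,1,\dots$: let $\hat\imath\in\arg\min_{0\le i\le p}\widetilde\nabla f(x_n)^\top a_i$, $h_n=a_{\hat\imath}-x_n$, $\hat\jmath\in\arg\max_{j\in S_n}\widetilde\nabla f(x_n)^\top a_j$, $b_n=x_n-a_{\hat\jmath}$. If $-\widetilde\nabla f(x_n)^\top h_n\ge-\widetilde\nabla f(x_n)^\top b_n$, set $d_n=h_n$, $\eta_n^{\max}=1$; else set $d_n=b_n$, $\eta_n^{\max}=w_n^{\hat\jmath}/(1-w_n^{\hat\jmath})$. Choose $\eta_n\in(0,\eta_n^{\max}]$ by a line search, set $x_{n+1}=x_n+\eta_nd_n$. Weights: if $d_n=h_n$ was selected, $w_{n+1}^j=(1-\eta_n)w_n^j$ for $j\neq\hat\imath$ and $w_{n+1}^{\hat\imath}=(1-\eta_n)w_n^{\hat\imath}+\eta_n$; if $d_n=b_n$ was selected, $w_{n+1}^j=(1+\eta_n)w_n^j$ for $j\ne\hat\jmath$ and $w_{n+1}^{\hat\jmath}=(1+\eta_n)w_n^{\hat\jmath}-\eta_n$. Stop after this iteration if $-\widetilde\nabla f(x_n)^\top h_n\le\tau$. Inexact pairwise Frank-Wolfe algorithm with controlled swaps. Same polytope, initialization, weights and definitions of $\hat\imath,\hat\jmath,h_n,b_n,S_n$; a counter $r$ starts at $0$. For $n=0,1,\dots$: set $d_n=h_n+b_n=a_{\hat\imath}-a_{\hat\jmath}$,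 $\eta_n^{\max}=w_n^{\hat\jmath}$, choose $\eta_n\in(0,\eta_n^{\max}]$ by a line search. If $\eta_n=\eta_n^{\max}$ and $\hat\imath\notin S_n$, increase $r$ by $1$. If $r\le R$: $x_{n+1}=x_n+\eta_nd_n$, $w_{n+1}^{\hat\imath}=w_n^{\hat\imath}+\eta_n$, $w_{n+1}^{\hat\jmath}=w_n^{\hat\jmath}-\eta_n$, other weights unchanged. Otherwise, re-choose $d_n,\eta_n^{\max},\eta_n$ and update $x_{n+1}$ and the weights as in one iteration of the away-step algorithm, and reset $r=0$. Stop after this iteration if $-\widetilde\nabla f(x_n)^\top d_n\le\tau$. Notation: $\tilde g_n=-\widetilde\nabla f(x_n)^\top d_n$ (with the $d_n,\eta_n,\eta_n^{\max}$ actually used to form $x_{n+1}$); $g_n^{FW}=-\min_{x\in C}\nabla f(x_n)^\top(x-x_n)$; $g_N^*=\min_{0\le i\le N}g_i^{FW}$, where at termination $N$ is set to the index of the last iteration performed (numbered from $0$).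
   Formalization: At termination only g_N^* ≤ τ(1+2σ)/(1+σ) is shown; τ/(1+σ) holds if iterations 0..N, N ≥ N̄, are performed (false earlier if σ>0). "At most N̄" bounds the last index (0 if N̄=-1); lower iterations ≤ N̄T without iteration 0, (N̄+1)T with it; asymptotics for σ>0. *)

theory Defs
  imports "HOL-Analysis.Analysis" "HOL-Library.Landau_Symbols" "HOL-Library.Extended_Nat"
begin

definition grad :: "('a::real_inner \<Rightarrow> real) \<Rightarrow> 'a \<Rightarrow> 'a" where
  "grad f x = (THE D. GDERIV f x :> D)"

text \<open>Functions on \<open>\<real>\<^sup>d \<times> C\<close> are total functions here; the derivatives at points of
  \<open>\<real>\<^sup>d \<times> C\<close> are two-sided, so that gradients and Jacobians are unique even if \<open>C\<close> has
  empty interior.\<close>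

definition lipschitz_C1_on ::
    "('a::real_normed_vector \<Rightarrow> 'b::real_normed_vector) \<Rightarrow> 'a set \<Rightarrow> bool" where
  "lipschitz_C1_on F S \<longleftrightarrow>
     (\<exists>F'. (\<forall>p\<in>S. (F has_derivative blinfun_apply (F' p)) (at p)) \<and> continuous_on S F' \<and>
           (\<exists>K. K-lipschitz_on S F) \<and> (\<exists>K. K-lipschitz_on S F'))"

definition lower_sol :: "('a \<times> 'b \<Rightarrow> 'a) \<Rightarrow> 'b \<Rightarrow> 'a" where
  "lower_sol \<Phi> x = (THE v. \<Phi> (v, x) = v)"

primrec lower_iter :: "('a::zero \<times> 'b \<Rightarrow> 'a) \<Rightarrow> nat \<Rightarrow> 'b \<Rightarrow> 'a" where
  "lower_iter \<Phi> 0 x = 0"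
| "lower_iter \<Phi> (Suc i) x = \<Phi> (lower_iter \<Phi> i x, x)"

definition itd_grad ::
    "((real^'d) \<times> (real^'d) \<Rightarrow> real) \<Rightarrow> ((real^'d) \<times> (real^'d) \<Rightarrow> real^'d) \<Rightarrow> nat
      \<Rightarrow> real^'d \<Rightarrow> real^'d" where
  "itd_grad E \<Phi> t x = grad (\<lambda>y. E (lower_iter \<Phi> t y, y)) x"

primrec adjoint_iter ::
    "((real^'d) \<times> (real^'d) \<Rightarrow> real) \<Rightarrow> ((real^'d) \<times> (real^'d) \<Rightarrow> real^'d) \<Rightarrow> nat
      \<Rightarrow> nat \<Rightarrow> real^'d \<Rightarrow> real^'d" where
  "adjoint_iter E \<Phi> t 0 x = 0"
| "adjoint_iter E \<Phi> t (Suc j) x =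
     transpose (jacobian (\<lambda>v. \<Phi> (v, x)) (at (lower_iter \<Phi> t x))) *v adjoint_iter E \<Phi> t j x
     + grad (\<lambda>v. E (v, x)) (lower_iter \<Phi> t x)"

definition aid_grad ::
    "((real^'d) \<times> (real^'d) \<Rightarrow> real) \<Rightarrow> ((real^'d) \<times> (real^'d) \<Rightarrow> real^'d) \<Rightarrow> nat
      \<Rightarrow> nat \<Rightarrow> real^'d \<Rightarrow> real^'d" where
  "aid_grad E \<Phi> t k x =
     grad (\<lambda>y. E (lower_iter \<Phi> t x, y)) x
     + transpose (jacobian (\<lambda>y. \<Phi> (lower_iter \<Phi> t x, y)) (at x)) *v adjoint_iter E \<Phi> t k x"

text \<open>The argument of \<open>ITD\<close> is the parameter \<open>\<epsilon>\<close> in its iteration number.\<close>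

datatype hypergrad_scheme = ITD real | AID

primrec hypergrad ::
    "hypergrad_scheme \<Rightarrow> ((real^'d) \<times> (real^'d) \<Rightarrow> real)
      \<Rightarrow> ((real^'d) \<times> (real^'d) \<Rightarrow> real^'d) \<Rightarrow> nat \<Rightarrow> real^'d \<Rightarrow> real^'d" where
  "hypergrad (ITD \<epsilon>) E \<Phi> t x = itd_grad E \<Phi> t x"
| "hypergrad AID E \<Phi> t x = aid_grad E \<Phi> t t x"

text \<open>For \<open>\<sigma> = 0\<close> the iteration number is \<open>log\<^sub>q 0 = \<infinity>\<close> (whereas \<open>log q 0 = 0\<close> in HOL); the
  estimate with \<open>\<infinity>\<close> iterations is the limit of the estimates. A negative value of the formula
  means that no lower-level iteration is needed.\<close>

definition scheme_iters ::
    "hypergrad_scheme \<Rightarrow> real \<Rightarrow> real \<Rightarrow> real \<Rightarrow> real \<Rightarrow> real \<Rightarrow> enat" where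
  "scheme_iters m \<sigma> \<tau> \<Delta> M q =
     (if \<sigma> = 0 then \<infinity> else enat (nat (case m of
        ITD \<epsilon> \<Rightarrow> \<lceil>1 / (1 - \<epsilon>) * log q (\<sigma> * \<tau> / ((1 + \<sigma>) * \<Delta> * M)
                   * (\<epsilon> * q * ln (1 / q) / (1 + 2 * \<epsilon> * q * ln (1 / q))))\<rceil>
      | AID \<Rightarrow> \<lceil>log q (\<sigma> * \<tau> / ((1 + \<sigma>) * \<Delta> * M) * ((1 - q) / (3 - 2 * q)))\<rceil>)))"

definition hypergrad_est ::
    "hypergrad_scheme \<Rightarrow> ((real^'d) \<times> (real^'d) \<Rightarrow> real)
      \<Rightarrow> ((real^'d) \<times> (real^'d) \<Rightarrow> real^'d) \<Rightarrow> enat \<Rightarrow> real^'d \<Rightarrow> real^'d" where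
  "hypergrad_est m E \<Phi> T x =
     (case T of enat t \<Rightarrow> hypergrad m E \<Phi> t x | \<infinity> \<Rightarrow> lim (\<lambda>t. hypergrad m E \<Phi> t x))"

definition hypergrad_error_const ::
    "(real^'d) set \<Rightarrow> ((real^'d) \<times> (real^'d) \<Rightarrow> real) \<Rightarrow> ((real^'d) \<times> (real^'d) \<Rightarrow> real^'d)
      \<Rightarrow> (real^'d \<Rightarrow> real) \<Rightarrow> (real^'d \<Rightarrow> real) \<Rightarrow> real \<Rightarrow> bool" where
  "hypergrad_error_const C E \<Phi> f qc M \<longleftrightarrow>
     (\<exists>c1 c2 c3. \<forall>x\<in>C.
        \<bar>c1 x\<bar> \<le> M \<and> \<bar>c2 x\<bar> \<le> M \<and> \<bar>c3 x\<bar> \<le> M \<and>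
        (\<forall>t. norm (itd_grad E \<Phi> t x - grad f x)
               \<le> (c1 x + c3 x) * qc x ^ t + c2 x * real t * qc x ^ (t - 1)) \<and>
        (\<forall>t k. norm (aid_grad E \<Phi> t k x - grad f x)
               \<le> (c1 x + c2 x / (1 - qc x)) * qc x ^ t + c3 x * qc x ^ k))"

text \<open>Vertices are \<open>a 0, \<dots>, a p\<close>; weights and swap counter are unused by the vanilla
  algorithm.\<close>

datatype fw_alg = Vanilla | Away_Step | Pairwise nat

datatype 'a fw_state = State (iterate: 'a) (weights: "nat \<Rightarrow> real") (swaps: nat)

text \<open>The direction, maximal step size and step size used to form the next iterate, and the
  direction that enters the stopping test (it differs from the first one for away steps).\<close>

datatype 'a fw_step = Step (direction: 'a) (eta_max: real) (eta: real) (test_direction: 'a)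

text \<open>From here on \<open>g\<close> is the estimated gradient at the current iterate, so that
  \<open>- (g \<bullet> d)\<close> is the estimated gap in the direction \<open>d\<close>.\<close>

definition eta_bar :: "real \<Rightarrow> 'a::real_inner \<Rightarrow> 'a \<Rightarrow> real \<Rightarrow> real" where
  "eta_bar L g d \<eta>max = min \<eta>max (- (g \<bullet> d) / (L * (norm d)\<^sup>2))"

definition line_search ::
    "('a::real_inner \<Rightarrow> real) \<Rightarrow> real \<Rightarrow> real \<Rightarrow> 'a \<Rightarrow> 'a \<Rightarrow> 'a \<Rightarrow> real \<Rightarrow> real \<Rightarrow> bool" where
  "line_search f L \<rho> g x d \<eta>max \<eta> \<longleftrightarrow>
     0 < \<eta> \<and> \<eta> \<le> \<eta>max \<and> \<eta> \<ge> eta_bar L g d \<eta>max \<and>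
     f x - f (x + \<eta> *\<^sub>R d) \<ge> \<rho> * eta_bar L g d \<eta>max * - (g \<bullet> d)"

definition active :: "nat \<Rightarrow> (nat \<Rightarrow> real) \<Rightarrow> nat set" where
  "active p w = {j. j \<le> p \<and> w j > 0}"

definition fw_vertex :: "(nat \<Rightarrow> 'a::real_inner) \<Rightarrow> nat \<Rightarrow> 'a \<Rightarrow> nat \<Rightarrow> bool" where
  "fw_vertex a p g i \<longleftrightarrow> i \<le> p \<and> (\<forall>k\<le>p. g \<bullet> a i \<le> g \<bullet> a k)"

definition away_vertex ::
    "(nat \<Rightarrow> 'a::real_inner) \<Rightarrow> nat \<Rightarrow> 'a \<Rightarrow> (nat \<Rightarrow> real) \<Rightarrow> nat \<Rightarrow> bool" where
  "away_vertex a p g w j \<longleftrightarrow> j \<in> active p w \<and> (\<forall>k\<in>active p w. g \<bullet> a k \<le> g \<bullet> a j)"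

definition vanilla_iteration ::
    "'a::real_inner set \<Rightarrow> ('a \<Rightarrow> real) \<Rightarrow> real \<Rightarrow> real \<Rightarrow> 'a \<Rightarrow> 'a \<Rightarrow> 'a fw_step \<Rightarrow> 'a \<Rightarrow> bool" where
  "vanilla_iteration C f L \<rho> g x s x' \<longleftrightarrow>
     (\<exists>y\<in>C. (\<forall>z\<in>C. g \<bullet> (y - x) \<le> g \<bullet> (z - x)) \<and>
        direction s = y - x \<and> test_direction s = y - x \<and> eta_max s = 1 \<and>
        line_search f L \<rho> g x (direction s) (eta_max s) (eta s) \<and>
        x' = x + eta s *\<^sub>R direction s)"

text \<open>Here the test direction is not constrained, because the away-step algorithm and the
  pairwise algorithm test different ones; \<open>i\<close> and \<open>j\<close> are the Frank-Wolfe and away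
  vertices.\<close>

definition away_update ::
    "(nat \<Rightarrow> 'a::real_inner) \<Rightarrow> nat \<Rightarrow> ('a \<Rightarrow> real) \<Rightarrow> real \<Rightarrow> real \<Rightarrow> 'a \<Rightarrow> 'a \<Rightarrow> (nat \<Rightarrow> real)
      \<Rightarrow> nat \<Rightarrow> nat \<Rightarrow> 'a fw_step \<Rightarrow> 'a \<Rightarrow> (nat \<Rightarrow> real) \<Rightarrow> bool" where
  "away_update a p f L \<rho> g x w i j s x' w' \<longleftrightarrow>
     fw_vertex a p g i \<and> away_vertex a p g w j \<and>
     (if - (g \<bullet> (a i - x)) \<ge> - (g \<bullet> (x - a j))
      then direction s = a i - x \<and> eta_max s = 1 \<and>
           w' = (\<lambda>k. (1 - eta s) * w k + (if k = i then eta s else 0))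
      else direction s = x - a j \<and> eta_max s = w j / (1 - w j) \<and>
           w' = (\<lambda>k. (1 + eta s) * w k - (if k = j then eta s else 0))) \<and>
     line_search f L \<rho> g x (direction s) (eta_max s) (eta s) \<and>
     x' = x + eta s *\<^sub>R direction s"

definition away_iteration ::
    "(nat \<Rightarrow> 'a::real_inner) \<Rightarrow> nat \<Rightarrow> ('a \<Rightarrow> real) \<Rightarrow> real \<Rightarrow> real \<Rightarrow> 'a
      \<Rightarrow> 'a fw_state \<Rightarrow> 'a fw_step \<Rightarrow> 'a fw_state \<Rightarrow> bool" where
  "away_iteration a p f L \<rho> g S s S' \<longleftrightarrow>
     (\<exists>i j. away_update a p f L \<rho> g (iterate S) (weights S) i j s (iterate S') (weights S') \<and>
            test_direction s = a i - iterate S)"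

text \<open>\<open>\<eta>\<close> is the step size of the attempted pairwise step and \<open>r\<close> the value of the counter
  after the attempt.\<close>

definition pairwise_iteration ::
    "nat \<Rightarrow> (nat \<Rightarrow> 'a::real_inner) \<Rightarrow> nat \<Rightarrow> ('a \<Rightarrow> real) \<Rightarrow> real \<Rightarrow> real \<Rightarrow> 'a
      \<Rightarrow> 'a fw_state \<Rightarrow> 'a fw_step \<Rightarrow> 'a fw_state \<Rightarrow> bool" where
  "pairwise_iteration R a p f L \<rho> g S s S' \<longleftrightarrow>
     test_direction s = direction s \<and>
     (\<exists>i j \<eta> r. fw_vertex a p g i \<and> away_vertex a p g (weights S) j \<and>
        0 < \<eta> \<and> \<eta> \<le> weights S j \<and>
        r = (if \<eta> = weights S j \<and> i \<notin> active p (weights S) then swaps S + 1 else swaps S) \<and>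
        (if r \<le> R
         then direction s = a i - a j \<and> eta_max s = weights S j \<and> eta s = \<eta> \<and>
              line_search f L \<rho> g (iterate S) (direction s) (eta_max s) (eta s) \<and>
              iterate S' = iterate S + eta s *\<^sub>R direction s \<and>
              weights S' = (\<lambda>k. weights S k + (if k = i then eta s else 0)
                                            - (if k = j then eta s else 0)) \<and>
              swaps S' = r
         else (\<exists>i' j'. away_update a p f L \<rho> g (iterate S) (weights S) i' j' s
                         (iterate S') (weights S')) \<and>
              swaps S' = 0))"

definition fw_iteration ::
    "fw_alg \<Rightarrow> 'a::real_inner set \<Rightarrow> (nat \<Rightarrow> 'a) \<Rightarrow> nat \<Rightarrow> ('a \<Rightarrow> real) \<Rightarrow> real \<Rightarrow> real
      \<Rightarrow> ('a \<Rightarrow> 'a) \<Rightarrow> 'a fw_state \<Rightarrow> 'a fw_step \<Rightarrow> 'a fw_state \<Rightarrow> bool" where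
  "fw_iteration alg C a p f L \<rho> G S s S' \<longleftrightarrow>
     (case alg of
        Vanilla \<Rightarrow> vanilla_iteration C f L \<rho> (G (iterate S)) (iterate S) s (iterate S')
      | Away_Step \<Rightarrow> away_iteration a p f L \<rho> (G (iterate S)) S s S'
      | Pairwise R \<Rightarrow> pairwise_iteration R a p f L \<rho> (G (iterate S)) S s S')"

definition fw_init ::
    "fw_alg \<Rightarrow> 'a set \<Rightarrow> (nat \<Rightarrow> 'a) \<Rightarrow> nat \<Rightarrow> 'a \<Rightarrow> 'a fw_state \<Rightarrow> bool" where
  "fw_init alg C a p x0 S \<longleftrightarrow>
     iterate S = x0 \<and> x0 \<in> C \<and>
     (alg \<noteq> Vanilla \<longrightarrow>
        (\<exists>i0\<le>p. x0 = a i0 \<and> weights S = (\<lambda>j. if j = i0 then 1 else 0)) \<and> swaps S = 0)"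

definition fw_stops ::
    "('a::real_inner \<Rightarrow> 'a) \<Rightarrow> real \<Rightarrow> (nat \<Rightarrow> 'a fw_state) \<Rightarrow> (nat \<Rightarrow> 'a fw_step) \<Rightarrow> nat \<Rightarrow> bool" where
  "fw_stops G \<tau> S s n \<longleftrightarrow> - (G (iterate (S n)) \<bullet> test_direction (s n)) \<le> \<tau>"

text \<open>A run with tolerance \<open>\<tau>\<close>: iteration \<open>n\<close> is performed as long as no earlier test
  succeeded. The entries of the sequences after the last iteration are irrelevant.\<close>

definition fw_run ::
    "fw_alg \<Rightarrow> 'a::real_inner set \<Rightarrow> (nat \<Rightarrow> 'a) \<Rightarrow> nat \<Rightarrow> ('a \<Rightarrow> real) \<Rightarrow> real \<Rightarrow> real
      \<Rightarrow> ('a \<Rightarrow> 'a) \<Rightarrow> real \<Rightarrow> 'a \<Rightarrow> (nat \<Rightarrow> 'a fw_state) \<Rightarrow> (nat \<Rightarrow> 'a fw_step) \<Rightarrow> bool" where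
  "fw_run alg C a p f L \<rho> G \<tau> x0 S s \<longleftrightarrow>
     fw_init alg C a p x0 (S 0) \<and>
     (\<forall>n. (\<forall>i<n. \<not> fw_stops G \<tau> S s i) \<longrightarrow>
          fw_iteration alg C a p f L \<rho> G (S n) (s n) (S (Suc n)))"

definition fw_terminates_at ::
    "('a::real_inner \<Rightarrow> 'a) \<Rightarrow> real \<Rightarrow> (nat \<Rightarrow> 'a fw_state) \<Rightarrow> (nat \<Rightarrow> 'a fw_step) \<Rightarrow> nat \<Rightarrow> bool" where
  "fw_terminates_at G \<tau> S s N \<longleftrightarrow> fw_stops G \<tau> S s N \<and> (\<forall>n<N. \<not> fw_stops G \<tau> S s n)"

text \<open>The iterations \<open>0, \<dots>, N\<close> are performed, whether or not the stopping test succeeds in one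
  of them.\<close>

definition fw_performs ::
    "fw_alg \<Rightarrow> 'a::real_inner set \<Rightarrow> (nat \<Rightarrow> 'a) \<Rightarrow> nat \<Rightarrow> ('a \<Rightarrow> real) \<Rightarrow> real \<Rightarrow> real
      \<Rightarrow> ('a \<Rightarrow> 'a) \<Rightarrow> 'a \<Rightarrow> (nat \<Rightarrow> 'a fw_state) \<Rightarrow> (nat \<Rightarrow> 'a fw_step) \<Rightarrow> nat \<Rightarrow> bool" where
  "fw_performs alg C a p f L \<rho> G x0 S s N \<longleftrightarrow>
     fw_init alg C a p x0 (S 0) \<and>
     (\<forall>n\<le>N. fw_iteration alg C a p f L \<rho> G (S n) (s n) (S (Suc n)))"

definition fw_gap :: "'a::real_inner set \<Rightarrow> ('a \<Rightarrow> real) \<Rightarrow> 'a \<Rightarrow> real" where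
  "fw_gap C f x = - (INF y\<in>C. grad f x \<bullet> (y - x))"

definition best_gap ::
    "'a::real_inner set \<Rightarrow> ('a \<Rightarrow> real) \<Rightarrow> (nat \<Rightarrow> 'a fw_state) \<Rightarrow> nat \<Rightarrow> real" where
  "best_gap C f S N = Min ((\<lambda>i. fw_gap C f (iterate (S i))) ` {..N})"

definition fw_factor :: "fw_alg \<Rightarrow> real" where
  "fw_factor alg = (case alg of Vanilla \<Rightarrow> 1 | Away_Step \<Rightarrow> 2 | Pairwise R \<Rightarrow> 2 * (real R + 1))"

definition iter_bound ::
    "fw_alg \<Rightarrow> 'a::real_inner set \<Rightarrow> ('a \<Rightarrow> real) \<Rightarrow> real \<Rightarrow> real \<Rightarrow> real \<Rightarrow> 'a \<Rightarrow> real \<Rightarrow> int" where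
  "iter_bound alg C f L \<rho> \<sigma> x0 \<tau> =
     (let h = f x0 - (INF x\<in>C. f x);
          \<alpha>1 = (diameter C)\<^sup>2 * L * h * (1 + \<sigma>)\<^sup>2 / (\<tau>\<^sup>2 * \<rho> * (1 - \<sigma>)\<^sup>2);
          \<alpha>2 = 2 * h * (1 + \<sigma>) / (\<tau> * (1 - 3 * \<sigma>))
      in \<lceil>fw_factor alg * max \<alpha>1 \<alpha>2\<rceil> - 1)"

end

theory Submission
  imports Defs
begin

text \<open>The number \<open>T\<close> of lower-level iterations is the one for which the geometrically decaying error
bounds push \<open>\<parallel>\<nabla>f(x) - g(x)\<parallel> \<cdot> \<Delta>\<close> below \<open>e = \<sigma> \<tau> / (1 + \<sigma>)\<close> at all \<open>x \<in> C\<close>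
(\<open>hypergrad_est_error\<close>). From there on only this bound on the estimate \<open>g\<close> matters, and the
exact and the estimated gap in any feasible direction differ by at most \<open>e\<close>.

As long as the problem is not solved to the desired accuracy, the estimated gap in the search
direction exceeds \<open>\<gamma> = \<tau> (1 - \<sigma>) / (1 + \<sigma>)\<close>: if the stopping test fails it even exceeds
\<open>\<tau>\<close>, and if the exact gap exceeds \<open>\<tau> / (1 + \<sigma>)\<close> it exceeds \<open>\<tau> / (1 + \<sigma>) - e = \<gamma>\<close>. Under this
condition a step whose length is not cut off below 1 by the maximal step size decreases \<open>f\<close> by
more than \<open>\<delta> = min (\<rho> \<gamma>\<^sup>2 / (L \<Delta>\<^sup>2)) (\<gamma> / 2 - e)\<close> (\<open>guaranteed_decrease\<close>); the first term comes
from the line search, the second from the descent lemma for functions with Lipschitz gradient.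
The two terms of \<open>\<delta>\<close> are the ones that produce \<open>\<alpha>\<^sub>1\<close> and \<open>\<alpha>\<^sub>2\<close>: writing \<open>h = f(x\<^sub>0) - f\<^sup>*\<close>, one has
\<open>h / \<delta> = max \<alpha>\<^sub>1 \<alpha>\<^sub>2\<close> (\<open>iter_bound_eq\<close>).

The remaining steps (drop steps and swap steps) only do not increase \<open>f\<close>, and they have to be
paid for by the others. This is an amortized count: a potential on the states, called
\<open>credit\<close>, starts at 0, grows by at most \<open>\<kappa> - 1\<close> in a step with guaranteed decrease and shrinks by at
least 1 in any other step (\<open>fw_iteration_credit\<close>). Hence \<open>n\<close> iterations need a total decrease of
more than \<open>n \<delta> / \<kappa>\<close>, and since at most \<open>h\<close> is available, \<open>n < \<kappa> h / \<delta>\<close>. For a run this bounds the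
number of failed stopping tests; for a sequence of \<open>\<lceil>\<kappa> h / \<delta>\<rceil>\<close> or more iterations it shows that in one
of them the exact gap was at most \<open>\<tau> / (1 + \<sigma>)\<close>. At the iterate where a run stops, the estimated gap
is at most \<open>\<tau>\<close>, so the exact one is at most \<open>\<tau> + e = \<tau> (1 + 2 \<sigma>) / (1 + \<sigma>)\<close>.\<close>

section \<open>Error of the hypergradient estimates\<close>

text \<open>Both schemes have an error of at most \<open>M * scheme_factor m q * scheme_rate m q ^ t\<close> after \<open>t\<close>
iterations. For ITD the polynomial factor in \<open>t q\<^sup>t\<^sup>-\<^sup>1\<close> is absorbed by giving up the part
\<open>q powr \<epsilon>\<close> of the rate; this is the role of \<open>\<epsilon>\<close> in the iteration number.\<close>

definition scheme_rate :: "hypergrad_scheme \<Rightarrow> real \<Rightarrow> real" where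
  "scheme_rate m q = (case m of ITD \<epsilon> \<Rightarrow> q powr (1 - \<epsilon>) | AID \<Rightarrow> q)"

definition scheme_factor :: "hypergrad_scheme \<Rightarrow> real \<Rightarrow> real" where
  "scheme_factor m q =
     (case m of ITD \<epsilon> \<Rightarrow> (1 + 2 * \<epsilon> * q * ln (1 / q)) / (\<epsilon> * q * ln (1 / q))
      | AID \<Rightarrow> (3 - 2 * q) / (1 - q))"

lemma scheme_rate_bounds:
  assumes "0 < q" "q < 1" "\<And>\<epsilon>. m = ITD \<epsilon> \<Longrightarrow> 0 < \<epsilon> \<and> \<epsilon> < 1"
  shows "0 < scheme_rate m q" "scheme_rate m q < 1"
proof -
  show "0 < scheme_rate m q" "scheme_rate m q < 1"
    using assms powr_less_mono2[of "1 - \<epsilon>" q 1 for \<epsilon>]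
    by (auto simp: scheme_rate_def split: hypergrad_scheme.split)
qed

lemma scheme_factor_pos:
  assumes "0 < q" "q < 1" "\<And>\<epsilon>. m = ITD \<epsilon> \<Longrightarrow> 0 < \<epsilon> \<and> \<epsilon> < 1"
  shows "0 < scheme_factor m q"
proof (cases m)
  case (ITD \<epsilon>)
  have "0 < \<epsilon> * q * ln (1 / q)"
    using assms ITD by auto
  then show ?thesis
    unfolding scheme_factor_def ITD by (auto intro!: divide_pos_pos)
next
  case AID
  then show ?thesis
    using assms by (auto simp: scheme_factor_def)
qed

text \<open>In this form both iteration numbers solve the same inequality: \<open>M\<close> times the geometric error bound
has to be at most \<open>\<sigma> \<tau> / ((1 + \<sigma>) \<Delta>)\<close>.\<close>

lemma scheme_iters_eq_log:
  assumes "0 < q" "q < 1" "\<And>\<epsilon>. m = ITD \<epsilon> \<Longrightarrow> 0 < \<epsilon> \<and> \<epsilon> < 1"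
  shows "scheme_iters m \<sigma> \<tau> \<Delta> M q =
    (if \<sigma> = 0 then \<infinity>
     else enat (nat \<lceil>log (scheme_rate m q) (\<sigma> * \<tau> / ((1 + \<sigma>) * \<Delta> * M) / scheme_factor m q)\<rceil>))"
proof (cases m)
  case (ITD \<epsilon>)
  have "log (q powr (1 - \<epsilon>)) y = 1 / (1 - \<epsilon>) * log q y" for y
    using assms ITD by (simp add: log_base_powr)
  then show ?thesis
    by (simp add: ITD scheme_iters_def scheme_rate_def scheme_factor_def)
qed (simp add: scheme_iters_def scheme_rate_def scheme_factor_def)

text \<open>This is \<open>y \<le> exp y\<close> at \<open>y = n ln (1 / u)\<close>.\<close>

lemma real_times_power_le:
  fixes u :: real
  assumes "0 < u" "u < 1"
  shows "real n * u ^ n \<le> 1 / ln (1 / u)"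
proof -
  have pos: "0 < ln (1 / u)"
    using assms by simp
  have "real n * ln (1 / u) \<le> exp (real n * ln (1 / u))"
    using exp_ge_add_one_self[of "real n * ln (1 / u)"] by linarith
  also have "\<dots> = (1 / u) ^ n"
    using assms by (simp only: exp_of_nat_mult) simp
  finally have "real n * ln (1 / u) * u ^ n \<le> 1"
    using assms by (simp add: power_divide field_simps)
  then show ?thesis
    using pos by (simp add: field_simps)
qed

lemma itd_rate:
  fixes q \<epsilon> :: real
  assumes "0 < q" "q < 1" "0 < \<epsilon>" "\<epsilon> < 1"
  shows "2 * q ^ t + real t * q ^ (t - 1)
    \<le> scheme_factor (ITD \<epsilon>) q * scheme_rate (ITD \<epsilon>) q ^ t"
proof -
  define u where "u = q powr \<epsilon>"
  define r where "r = q powr (1 - \<epsilon>)"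
  have u: "0 < u" "u < 1"
    using assms powr_less_mono2[of \<epsilon> q 1] by (auto simp: u_def)
  have r: "0 < r"
    using assms by (simp add: r_def)
  have l: "ln (1 / u) = \<epsilon> * ln (1 / q)" "0 < ln (1 / q)"
    using assms by (simp_all add: u_def ln_div ln_powr)
  have qt: "q ^ t = u ^ t * r ^ t"
    using assms by (simp add: u_def r_def flip: power_mult_distrib powr_add)
  have "real t * q ^ (t - 1) = real t * q ^ t / q"
    using assms by (cases t) simp_all
  also have "\<dots> = real t * u ^ t * r ^ t / q"
    by (simp add: qt)
  also have "\<dots> \<le> 1 / ln (1 / u) * r ^ t / q"
    using assms r real_times_power_le[OF u, of t]
    by (intro divide_right_mono mult_right_mono) auto
  finally have "real t * q ^ (t - 1) \<le> 1 / (\<epsilon> * q * ln (1 / q)) * r ^ t"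
    by (simp add: l mult_ac)
  moreover have "q ^ t \<le> r ^ t"
    using u r by (simp add: qt power_le_one mult_left_le_one_le)
  ultimately have "2 * q ^ t + real t * q ^ (t - 1) \<le> (2 + 1 / (\<epsilon> * q * ln (1 / q))) * r ^ t"
    by (simp only: distrib_right)
  also have "2 + 1 / (\<epsilon> * q * ln (1 / q)) = scheme_factor (ITD \<epsilon>) q"
    using assms l(2) by (simp add: scheme_factor_def add_divide_distrib)
  finally show ?thesis
    by (simp add: r_def scheme_rate_def)
qed

lemma hypergrad_error:
  assumes M: "hypergrad_error_const C E \<Phi> f qc M" "0 \<le> M"
    and x: "x \<in> C" "0 < qc x" "qc x \<le> q" and q: "q < 1"
    and m: "\<And>\<epsilon>. m = ITD \<epsilon> \<Longrightarrow> 0 < \<epsilon> \<and> \<epsilon> < 1"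
  shows "norm (hypergrad m E \<Phi> t x - grad f x)
    \<le> M * scheme_factor m q * scheme_rate m q ^ t"
proof -
  obtain c1 c2 c3 where c: "\<bar>c1\<bar> \<le> M" "\<bar>c2\<bar> \<le> M" "\<bar>c3\<bar> \<le> M"
    and itd: "norm (itd_grad E \<Phi> t x - grad f x)
      \<le> (c1 + c3) * qc x ^ t + c2 * real t * qc x ^ (t - 1)"
    and aid: "norm (aid_grad E \<Phi> t t x - grad f x)
      \<le> (c1 + c2 / (1 - qc x)) * qc x ^ t + c3 * qc x ^ t"
    using M(1) x(1) unfolding hypergrad_error_const_def by metis
  have pow: "qc x ^ k \<le> q ^ k" "0 < qc x ^ k" for k
    using x by (auto intro: power_mono)
  show ?thesis
  proof (cases m)
    case (ITD \<epsilon>)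
    have "(c1 + c3) * qc x ^ t \<le> 2 * M * q ^ t"
      using c pow[of t] M(2) by (intro mult_mono) auto
    moreover have "c2 * (real t * qc x ^ (t - 1)) \<le> M * (real t * q ^ (t - 1))"
      using c pow[of "t - 1"] M(2) by (intro mult_mono) auto
    ultimately have "norm (hypergrad m E \<Phi> t x - grad f x)
        \<le> M * (2 * q ^ t + real t * q ^ (t - 1))"
      using itd by (simp add: ITD algebra_simps)
    also have "\<dots> \<le> M * (scheme_factor m q * scheme_rate m q ^ t)"
      using itd_rate[of q \<epsilon> t] x q m ITD M(2) by (intro mult_left_mono) auto
    finally show ?thesis
      by (simp add: mult.assoc)
  next
    case AID
    have "c2 / (1 - qc x) \<le> M / (1 - q)"
      using c x q M(2) by (intro frac_le) auto
    then have "c1 + c2 / (1 - qc x) + c3 \<le> M + M / (1 - q) + M"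
      using c by linarith
    also have "\<dots> = M * scheme_factor m q"
      using q by (simp add: AID scheme_factor_def field_simps)
    finally have "(c1 + c2 / (1 - qc x) + c3) * qc x ^ t \<le> M * scheme_factor m q * q ^ t"
      using pow[of t] M(2) x q m scheme_factor_pos[of q m] by (intro mult_mono) auto
    then show ?thesis
      using aid by (simp add: AID scheme_rate_def algebra_simps)
  qed
qed

text \<open>For \<open>\<sigma> = 0\<close> the estimate is a limit; the geometric error bound forces it to be the exact gradient.\<close>

lemma hypergrad_est_error:
  assumes M: "hypergrad_error_const C E \<Phi> f qc M" "0 < M"
    and x: "x \<in> C" "0 < qc x" "qc x \<le> q" and q: "q < 1"
    and m: "\<And>\<epsilon>. m = ITD \<epsilon> \<Longrightarrow> 0 < \<epsilon> \<and> \<epsilon> < 1"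
    and "0 \<le> \<sigma>" "0 < \<tau>" "0 < \<Delta>"
  shows "norm (hypergrad_est m E \<Phi> (scheme_iters m \<sigma> \<tau> \<Delta> M q) x - grad f x) * \<Delta>
    \<le> \<sigma> / (1 + \<sigma>) * \<tau>"
proof -
  define r where "r = scheme_rate m q"
  define K where "K = scheme_factor m q"
  have q0: "0 < q"
    using x by linarith
  have r: "0 < r" "r < 1" and K: "0 < K"
    using scheme_rate_bounds[OF q0 q m] scheme_factor_pos[OF q0 q m] by (simp_all add: r_def K_def)
  have err: "norm (hypergrad m E \<Phi> t x - grad f x) \<le> M * K * r ^ t" for t
    using hypergrad_error[OF M(1) _ x q m] M(2) unfolding r_def K_def by simp
  show ?thesis
  proof (cases "\<sigma> = 0")
    case True
    have "(\<lambda>t. r ^ t) \<longlonglongrightarrow> 0"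
      using r by (intro LIMSEQ_power_zero) auto
    then have "(\<lambda>t. M * K * r ^ t) \<longlonglongrightarrow> 0"
      by (rule tendsto_mult_right_zero)
    with always_eventually have "(\<lambda>t. hypergrad m E \<Phi> t x - grad f x) \<longlonglongrightarrow> 0"
      by (rule Lim_null_comparison) (use err in blast)
    then have "lim (\<lambda>t. hypergrad m E \<Phi> t x) = grad f x"
      by (intro limI) (rule LIM_zero_cancel)
    then show ?thesis
      using True by (simp add: scheme_iters_def hypergrad_est_def)
  next
    case False
    define B where "B = \<sigma> * \<tau> / ((1 + \<sigma>) * \<Delta> * M) / K"
    define t where "t = nat \<lceil>log r B\<rceil>"
    have B: "0 < B"
      using assms False K by (auto simp: B_def)
    have T: "scheme_iters m \<sigma> \<tau> \<Delta> M q = enat t"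
      using scheme_iters_eq_log[OF q0 q m] False by (simp add: t_def B_def r_def K_def)
    have "log r B \<le> real t"
      unfolding t_def by linarith
    then have "r powr real t \<le> r powr log r B"
      using r by (intro powr_mono') auto
    then have rt: "r ^ t \<le> B"
      using r B by (simp add: powr_realpow)
    have "norm (hypergrad m E \<Phi> t x - grad f x) * \<Delta> \<le> M * K * r ^ t * \<Delta>"
      using err[of t] \<open>0 < \<Delta>\<close> by simp
    also have "\<dots> \<le> M * K * B * \<Delta>"
      using rt K M(2) \<open>0 < \<Delta>\<close> by simp
    also have "\<dots> = \<sigma> / (1 + \<sigma>) * \<tau>"
      using K M(2) \<open>0 < \<Delta>\<close> by (simp add: B_def)
    finally show ?thesis
      by (simp add: T hypergrad_est_def)
  qed
qed

section \<open>Decrease of the objective in one step\<close>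

text \<open>The function \<open>\<phi>\<close> of the proof is the difference of the two sides along the segment, as a function of
the position on it. Its derivative is nonpositive by the Lipschitz condition.\<close>

lemma lipschitz_grad_descent:
  fixes f :: "'a::real_inner \<Rightarrow> real"
  assumes f: "\<And>x. GDERIV f x :> grad f x" and L: "L-lipschitz_on UNIV (grad f)"
  shows "f (x + d) \<le> f x + grad f x \<bullet> d + L / 2 * (norm d)\<^sup>2"
proof -
  define \<phi> where "\<phi> = (\<lambda>t. f (x + t *\<^sub>R d) - t * (grad f x \<bullet> d) - L / 2 * (norm d)\<^sup>2 * t\<^sup>2)"
  have "\<exists>y. (\<phi> has_real_derivative y) (at t) \<and> y \<le> 0" if t: "0 \<le> t" "t \<le> 1" for t :: real
  proof (intro exI conjI)
    have "(f has_derivative (\<lambda>h. h \<bullet> grad f (x + t *\<^sub>R d))) (at (x + t *\<^sub>R d))"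
      using f by (simp add: gderiv_def)
    then have "((\<lambda>s. f (x + s *\<^sub>R d)) has_derivative (\<lambda>s. (s *\<^sub>R d) \<bullet> grad f (x + t *\<^sub>R d))) (at t)"
      by (rule has_derivative_compose[rotated]) (auto intro!: derivative_eq_intros)
    then have "((\<lambda>s. f (x + s *\<^sub>R d)) has_real_derivative (d \<bullet> grad f (x + t *\<^sub>R d))) (at t)"
      by (simp add: has_field_derivative_def mult.commute[of _ "d \<bullet> _"])
    then show "(\<phi> has_real_derivative
        (d \<bullet> grad f (x + t *\<^sub>R d) - grad f x \<bullet> d - L / 2 * (norm d)\<^sup>2 * (2 * t))) (at t)"
      unfolding \<phi>_def by (auto intro!: derivative_eq_intros)
    have "d \<bullet> (grad f (x + t *\<^sub>R d) - grad f x)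
        \<le> norm d * norm (grad f (x + t *\<^sub>R d) - grad f x)"
      by (rule norm_cauchy_schwarz)
    also have "\<dots> \<le> norm d * (L * norm (t *\<^sub>R d))"
      using lipschitz_onD[OF L, of "x + t *\<^sub>R d" x]
      by (intro mult_left_mono) (auto simp: dist_norm)
    also have "\<dots> = L * (norm d)\<^sup>2 * t"
      using t by (simp add: power2_eq_square)
    finally show "d \<bullet> grad f (x + t *\<^sub>R d) - grad f x \<bullet> d - L / 2 * (norm d)\<^sup>2 * (2 * t) \<le> 0"
      by (simp add: inner_diff_right inner_commute)
  qed
  then have "\<phi> 1 \<le> \<phi> 0"
    using DERIV_nonpos_imp_nonincreasing[of 0 1 \<phi>] by simp
  then show ?thesis
    by (simp add: \<phi>_def)
qed

text \<open>Excluded are only steps whose length may be dictated by a maximal step size below 1, as in drop and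
swap steps. A swap with maximal step size 1 moves the whole weight and thus is a full
Frank-Wolfe step, for which the descent lemma applies.\<close>

definition guaranteed :: "real \<Rightarrow> 'a::real_inner \<Rightarrow> 'a fw_step \<Rightarrow> bool" where
  "guaranteed L g s \<longleftrightarrow> eta_bar L g (direction s) (eta_max s) < eta_max s \<or> 1 \<le> eta_max s"

lemma line_search_nonincreasing:
  assumes "line_search f L \<rho> g x d \<eta>max \<eta>" "0 \<le> - (g \<bullet> d)" "0 < L" "0 < \<rho>"
  shows "f (x + \<eta> *\<^sub>R d) \<le> f x"
proof -
  have "0 \<le> eta_bar L g d \<eta>max"
    using assms by (auto simp: line_search_def eta_bar_def divide_nonpos_nonneg)
  then have "0 \<le> \<rho> * eta_bar L g d \<eta>max * - (g \<bullet> d)"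
    using assms by (intro mult_nonneg_nonneg) auto
  then show ?thesis
    using assms(1) by (auto simp: line_search_def)
qed

text \<open>If \<open>eta_bar\<close> is the ratio \<open>b\<close> of gap and curvature, then the line search condition bounds the
decrease by \<open>\<rho> b\<close> times the gap. Otherwise the step size is at least 1 and at most \<open>b\<close>; then the
quadratic term of the descent lemma eats up at most half of the estimated gap, and the error of the
gradient costs at most \<open>e\<close> more. In this case \<open>\<rho>\<close> does not enter the bound.\<close>

lemma guaranteed_decrease:
  fixes f :: "'a::real_inner \<Rightarrow> real"
  assumes f: "\<And>x. GDERIV f x :> grad f x" and L: "L-lipschitz_on UNIV (grad f)" "0 < L"
    and ls: "line_search f L \<rho> g x (direction s) (eta_max s) (eta s)" and \<rho>: "0 < \<rho>"
    and good: "guaranteed L g s"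
    and err: "norm (g - grad f x) * \<Delta> \<le> e" and d: "norm (direction s) \<le> \<Delta>"
    and \<gamma>: "\<gamma> < - (g \<bullet> direction s)" "0 < \<gamma>" "e < \<gamma> / 2"
  shows "min (\<rho> * \<gamma>\<^sup>2 / (L * \<Delta>\<^sup>2)) (\<gamma> / 2 - e) < f x - f (x + eta s *\<^sub>R direction s)"
proof -
  define d where "d = direction s"
  define \<eta> where "\<eta> = eta s"
  define gt where "gt = - (g \<bullet> d)"
  define b where "b = gt / (L * (norm d)\<^sup>2)"
  have gt: "\<gamma> < gt" "0 < gt"
    using \<gamma> by (auto simp: gt_def d_def)
  then have "d \<noteq> 0"
    by (auto simp: gt_def)
  then have nd: "0 < norm d" "norm d \<le> \<Delta>"
    using d by (auto simp: d_def)
  have eb: "eta_bar L g d (eta_max s) = min (eta_max s) b"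
    by (simp add: eta_bar_def b_def gt_def)
  show ?thesis
  proof (cases "b < eta_max s")
    case True
    then have "\<rho> * (gt\<^sup>2 / (L * (norm d)\<^sup>2)) \<le> f x - f (x + \<eta> *\<^sub>R d)"
      using ls by (simp add: line_search_def eb gt_def b_def power2_eq_square
          flip: d_def \<eta>_def)
    moreover have "\<gamma>\<^sup>2 < gt\<^sup>2" "L * (norm d)\<^sup>2 \<le> L * \<Delta>\<^sup>2" "0 < L * (norm d)\<^sup>2"
      using gt \<gamma>(2) nd L(2) by (simp_all add: power_strict_mono power_mono)
    then have "\<gamma>\<^sup>2 / (L * \<Delta>\<^sup>2) < gt\<^sup>2 / (L * (norm d)\<^sup>2)"
      by (intro frac_less) auto
    then have "\<rho> * (\<gamma>\<^sup>2 / (L * \<Delta>\<^sup>2)) < \<rho> * (gt\<^sup>2 / (L * (norm d)\<^sup>2))"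
      using \<rho> by (rule mult_strict_left_mono)
    ultimately have "\<rho> * \<gamma>\<^sup>2 / (L * \<Delta>\<^sup>2) < f x - f (x + \<eta> *\<^sub>R d)"
      by simp
    then show ?thesis
      unfolding d_def \<eta>_def by (rule min.strict_coboundedI1)
  next
    case False
    then have \<eta>: "1 \<le> \<eta>" "\<eta> \<le> b"
      using ls good by (auto simp: line_search_def guaranteed_def eb \<eta>_def simp flip: d_def)
    have "L * (norm d)\<^sup>2 * \<eta> \<le> gt"
      using \<eta>(2) nd L(2) by (simp add: b_def field_simps)
    then have "\<eta> * (L * (norm d)\<^sup>2 * \<eta>) \<le> \<eta> * gt"
      using \<eta> by (intro mult_left_mono) auto
    then have sq: "L / 2 * (norm (\<eta> *\<^sub>R d))\<^sup>2 \<le> \<eta> * gt / 2"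
      using \<eta> by (simp add: power_mult_distrib) (simp add: power2_eq_square mult_ac)
    have "(grad f x - g) \<bullet> d \<le> norm (grad f x - g) * norm d"
      by (rule norm_cauchy_schwarz)
    also have "\<dots> \<le> norm (grad f x - g) * \<Delta>"
      using nd by (intro mult_left_mono) auto
    finally have "grad f x \<bullet> d \<le> e - gt"
      using err unfolding gt_def inner_diff_left norm_minus_commute[of g] by linarith
    then have "\<eta> * (grad f x \<bullet> d) \<le> \<eta> * (e - gt)"
      using \<eta> by (intro mult_left_mono) auto
    then have "f (x + \<eta> *\<^sub>R d) \<le> f x - \<eta> * (gt / 2 - e)"
      using lipschitz_grad_descent[OF f L(1), of x "\<eta> *\<^sub>R d"] sq by (simp add: algebra_simps)
    moreover have "gt / 2 - e \<le> \<eta> * (gt / 2 - e)"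
      using mult_right_mono[of 1 \<eta> "gt / 2 - e"] \<eta> gt \<gamma> by simp
    ultimately have "\<gamma> / 2 - e < f x - f (x + \<eta> *\<^sub>R d)"
      using gt by linarith
    then show ?thesis
      unfolding d_def \<eta>_def by (rule min.strict_coboundedI2)
  qed
qed

section \<open>Convex weights and active vertices\<close>

definition barycentric :: "(nat \<Rightarrow> 'a::real_vector) \<Rightarrow> nat \<Rightarrow> (nat \<Rightarrow> real) \<Rightarrow> 'a \<Rightarrow> bool" where
  "barycentric a p w x \<longleftrightarrow>
     (\<forall>k\<le>p. 0 \<le> w k) \<and> (\<Sum>k\<le>p. w k) = 1 \<and> x = (\<Sum>k\<le>p. w k *\<^sub>R a k)"

lemma barycentric_in_hull:
  assumes "barycentric a p w x"
  shows "x \<in> convex hull (a ` {0..p})"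
  using assms unfolding barycentric_def
  by (auto intro!: convex_sum[OF _ convex_convex_hull] intro: hull_inc)

lemma fw_vertex_minimizes_hull:
  assumes "fw_vertex a p g i" "y \<in> convex hull (a ` {0..p})"
  shows "g \<bullet> a i \<le> g \<bullet> y"
proof -
  have "convex hull (a ` {0..p}) \<subseteq> {y. g \<bullet> a i \<le> g \<bullet> y}"
    using assms(1) by (intro hull_minimal convex_halfspace_ge) (auto simp: fw_vertex_def)
  then show ?thesis
    using assms(2) by auto
qed

lemma away_vertex_ge:
  assumes "barycentric a p w x" "away_vertex a p g w j"
  shows "g \<bullet> x \<le> g \<bullet> a j"
proof -
  have "g \<bullet> x = (\<Sum>k\<le>p. w k * (g \<bullet> a k))"
    using assms(1) by (simp add: barycentric_def inner_sum_right)
  also have "\<dots> \<le> (\<Sum>k\<le>p. w k * (g \<bullet> a j))"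
  proof (intro sum_mono)
    fix k assume "k \<in> {..p}"
    then have "w k = 0 \<or> k \<in> active p w \<and> 0 \<le> w k"
      using assms(1) by (auto simp: barycentric_def active_def less_le)
    then show "w k * (g \<bullet> a k) \<le> w k * (g \<bullet> a j)"
      using assms(2) by (auto simp: away_vertex_def intro: mult_left_mono)
  qed
  also have "\<dots> = g \<bullet> a j"
    using assms(1) by (simp add: barycentric_def flip: sum_distrib_right)
  finally show ?thesis .
qed

lemma finite_active [simp]: "finite (active p w)"
  unfolding active_def by simp

lemma sum_active:
  assumes "barycentric a p w x"
  shows "sum w (active p w) = 1"
proof -
  have "sum w (active p w) = sum w {..p}"
    using assms by (intro sum.mono_neutral_left) (auto simp: barycentric_def active_def less_le)
  then show ?thesis
    using assms by (simp add: barycentric_def)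
qed

lemma active_nonempty:
  assumes "barycentric a p w x"
  shows "0 < card (active p w)"
  using sum_active[OF assms] by (auto simp: card_gt_0_iff)

text \<open>This shows that a swap between two vertices that exchanges a weight below 1 takes place while at
least two vertices are active. Swaps with a single active vertex therefore have maximal step size
1 and belong to the steps with guaranteed decrease.\<close>

lemma card_active_ge_2:
  assumes "barycentric a p w x" "j \<in> active p w" "w j < 1"
  shows "2 \<le> card (active p w)"
proof (rule ccontr)
  assume "\<not> 2 \<le> card (active p w)"
  then have "card (active p w) = 1"
    using active_nonempty[OF assms(1)] by linarith
  then have "active p w = {j}"
    using assms(2) by (auto simp: card_1_singleton_iff)
  then show False
    using sum_active[OF assms(1)] assms(3) by simp
qed

text \<open>The maximal step size of an away step is \<open>u / (1 - u)\<close>. In HOL it would be 0 for \<open>u = 1\<close>, so a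
positive step size excludes this case.\<close>

lemma away_step_bounds:
  fixes u \<eta> :: real
  assumes "0 < u" "0 < \<eta>" "\<eta> \<le> u / (1 - u)"
  shows "u < 1" "\<eta> * (1 - u) \<le> u"
proof -
  show "u < 1"
  proof (rule ccontr)
    assume "\<not> u < 1"
    then have "u / (1 - u) \<le> 0"
      using assms(1) by (intro divide_nonneg_nonpos) auto
    then show False
      using assms by linarith
  qed
  then show "\<eta> * (1 - u) \<le> u"
    using assms(3) by (simp add: field_simps)
qed

lemma barycentric_update:
  assumes w: "barycentric a p w x" and ij: "i \<le> p" "j \<le> p" and c: "c + b - e = 1"
    and w': "\<And>k. w' k = c * w k + (if k = i then b else 0) - (if k = j then e else 0)"
    and nonneg: "\<And>k. k \<le> p \<Longrightarrow> 0 \<le> w' k"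
    and x': "x' = c *\<^sub>R x + b *\<^sub>R a i - e *\<^sub>R a j"
  shows "barycentric a p w' x'"
proof -
  have 1: "(\<Sum>k\<le>p. w k) = 1" and 2: "(\<Sum>k\<le>p. w k *\<^sub>R a k) = x"
    using w by (auto simp: barycentric_def)
  have "(\<Sum>k\<le>p. w' k) = c * (\<Sum>k\<le>p. w k) + b - e"
    using ij by (simp add: w' sum.distrib sum_subtractf sum_distrib_left)
  moreover have "w' k *\<^sub>R a k = c *\<^sub>R (w k *\<^sub>R a k) + (if k = i then b *\<^sub>R a i else 0)
      - (if k = j then e *\<^sub>R a j else 0)" for k
    by (simp add: w' algebra_simps)
  then have "(\<Sum>k\<le>p. w' k *\<^sub>R a k) = c *\<^sub>R (\<Sum>k\<le>p. w k *\<^sub>R a k) + b *\<^sub>R a i - e *\<^sub>R a j"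
    using ij by (simp only: sum.distrib sum_subtractf scaleR_sum_right) simp
  ultimately show ?thesis
    using c nonneg by (simp add: barycentric_def 1 2 x')
qed

lemma barycentric_toward:
  assumes "barycentric a p w x" "i \<le> p" "0 \<le> \<eta>" "\<eta> \<le> 1"
  shows "barycentric a p (\<lambda>k. (1 - \<eta>) * w k + (if k = i then \<eta> else 0)) (x + \<eta> *\<^sub>R (a i - x))"
proof (rule barycentric_update[OF assms(1,2,2), of "1 - \<eta>" \<eta> 0])
  show "0 \<le> (1 - \<eta>) * w k + (if k = i then \<eta> else 0)" if "k \<le> p" for k
    using assms that by (auto simp: barycentric_def)
qed (simp_all add: algebra_simps)

lemma barycentric_away:
  assumes "barycentric a p w x" "j \<le> p" "0 \<le> \<eta>" "\<eta> * (1 - w j) \<le> w j"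
  shows "barycentric a p (\<lambda>k. (1 + \<eta>) * w k - (if k = j then \<eta> else 0)) (x + \<eta> *\<^sub>R (x - a j))"
proof (rule barycentric_update[OF assms(1,2,2), of "1 + \<eta>" 0 \<eta>])
  show "0 \<le> (1 + \<eta>) * w k - (if k = j then \<eta> else 0)" if "k \<le> p" for k
  proof (cases "k = j")
    case True
    then show ?thesis
      using assms(4) by (simp add: algebra_simps)
  next
    case False
    then show ?thesis
      using assms that by (simp add: barycentric_def)
  qed
qed (simp_all add: algebra_simps)

lemma barycentric_pairwise:
  assumes "barycentric a p w x" "i \<le> p" "j \<le> p" "0 \<le> \<eta>" "\<eta> \<le> w j"
  shows "barycentric a p (\<lambda>k. w k + (if k = i then \<eta> else 0) - (if k = j then \<eta> else 0))
    (x + \<eta> *\<^sub>R (a i - a j))"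
proof (rule barycentric_update[OF assms(1,2,3), of 1 \<eta> \<eta>])
  show "0 \<le> w k + (if k = i then \<eta> else 0) - (if k = j then \<eta> else 0)" if "k \<le> p" for k
    using assms that by (auto simp: barycentric_def)
qed (simp_all add: algebra_simps)

lemma away_update_barycentric:
  assumes "barycentric a p w x" "away_update a p f L \<rho> g x w i j s x' w'"
  shows "barycentric a p w' x'"
proof (cases "- (g \<bullet> (a i - x)) \<ge> - (g \<bullet> (x - a j))")
  case True
  then show ?thesis
    using assms barycentric_toward[OF assms(1), of i "eta s"]
    by (auto simp: away_update_def line_search_def fw_vertex_def)
next
  case False
  then have "0 < w j" "0 < eta s" "eta s \<le> w j / (1 - w j)" "j \<le> p"
    using assms(2) by (auto simp: away_update_def line_search_def away_vertex_def active_def)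
  then show ?thesis
    using False assms(2) barycentric_away[OF assms(1), of j "eta s"] away_step_bounds
    by (auto simp: away_update_def)
qed

lemma away_update_card_active:
  assumes "barycentric a p w x" "away_update a p f L \<rho> g x w i j s x' w'"
  shows "card (active p w') \<le> card (active p w) + 1"
proof -
  have eta: "0 < eta s"
    using assms(2) by (auto simp: away_update_def line_search_def)
  have nn: "0 \<le> w k" if "k \<le> p" for k
    using assms(1) that by (auto simp: barycentric_def)
  have "active p w' \<subseteq> insert i (active p w)"
  proof
    fix k assume k: "k \<in> active p w'"
    have "0 < w k" if "k \<noteq> i" 
    proof (rule ccontr)
      assume "\<not> 0 < w k"
      then have "w k = 0"
        using nn k by (force simp: active_def)
      then have "w' k \<le> 0"
        using assms(2) that eta by (auto simp: away_update_def split: if_splits)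
      then show False
        using k by (simp add: active_def)
    qed
    then show "k \<in> insert i (active p w)"
      using k by (auto simp: active_def)
  qed
  then have "card (active p w') \<le> card (insert i (active p w))"
    by (intro card_mono) auto
  also have "\<dots> \<le> card (active p w) + 1"
    by (simp add: card_insert_if)
  finally show ?thesis .
qed

text \<open>Frank-Wolfe steps have maximal step size 1, so only an away step remains. Since \<open>eta_bar\<close> is not
below the maximal step size, the step size is the maximal one, for which the weight of the away
vertex becomes 0.\<close>

lemma away_update_drop:
  assumes "barycentric a p w x" "away_update a p f L \<rho> g x w i j s x' w'"
    and "\<not> guaranteed L g s"
  shows "card (active p w') < card (active p w)"
proof -
  have "\<not> - (g \<bullet> (a i - x)) \<ge> - (g \<bullet> (x - a j))"
    using assms(2,3) by (auto simp: away_update_def guaranteed_def)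
  then have up: "w' = (\<lambda>k. (1 + eta s) * w k - (if k = j then eta s else 0))"
    and j: "0 < w j" "j \<in> active p w" and ls: "0 < eta s" "eta s \<le> w j / (1 - w j)"
    and "w j / (1 - w j) \<le> eta s"
    using assms(2,3)
    by (auto simp: away_update_def line_search_def away_vertex_def active_def guaranteed_def
        split: if_splits)
  then have "w' j = 0"
    using away_step_bounds(1)[OF j(1) ls] by (simp add: field_simps)
  moreover have "0 < w k" if "0 < w' k" for k
  proof -
    have "0 < (1 + eta s) * w k"
      using that ls by (auto simp: up split: if_splits)
    then show ?thesis
      using ls by (simp add: zero_less_mult_iff)
  qed
  ultimately have "active p w' \<subset> active p w"
    using j by (force simp: active_def)
  then show ?thesis
    by (intro psubset_card_mono) auto
qed

section \<open>Iterations of the three algorithms\<close>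

lemma away_update_direction:
  assumes "barycentric a p w x" "away_update a p f L \<rho> g x w i j s x' w'"
  shows "\<exists>u\<in>convex hull (a ` {0..p}). \<exists>v\<in>convex hull (a ` {0..p}). direction s = u - v"
    and "- (g \<bullet> (a i - x)) \<le> - (g \<bullet> direction s)"
proof -
  have "i \<le> p" "j \<le> p"
    using assms(2) by (auto simp: away_update_def fw_vertex_def away_vertex_def active_def)
  then have "x \<in> convex hull (a ` {0..p})" "a i \<in> convex hull (a ` {0..p})"
      "a j \<in> convex hull (a ` {0..p})"
    using barycentric_in_hull[OF assms(1)] by (auto intro: hull_inc)
  then show "\<exists>u\<in>convex hull (a ` {0..p}). \<exists>v\<in>convex hull (a ` {0..p}). direction s = u - v"
    using assms(2) unfolding away_update_def by (metis (no_types, lifting))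
  show "- (g \<bullet> (a i - x)) \<le> - (g \<bullet> direction s)"
    using assms(2) by (auto simp: away_update_def split: if_splits)
qed

lemma active_pairwise_subset:
  fixes \<eta> :: real
  assumes "w' = (\<lambda>k. w k + (if k = i then \<eta> else 0) - (if k = j then \<eta> else 0))" "0 \<le> \<eta>"
  shows "active p w' \<subseteq> insert i (active p w)"
    and "\<lbrakk>i \<noteq> j; \<eta> = w j\<rbrakk> \<Longrightarrow> active p w' \<subseteq> insert i (active p w - {j})"
  using assms by (auto simp: active_def split: if_splits)

lemma pairwise_iteration_cases [consumes 1, case_names pairwise reset]:
  assumes "pairwise_iteration R a p f L \<rho> g S s S'"
  obtains (pairwise) i j where "fw_vertex a p g i" "away_vertex a p g (weights S) j"
      "direction s = a i - a j" "eta_max s = weights S j"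
      "line_search f L \<rho> g (iterate S) (direction s) (eta_max s) (eta s)"
      "iterate S' = iterate S + eta s *\<^sub>R direction s"
      "weights S' = (\<lambda>k. weights S k + (if k = i then eta s else 0) - (if k = j then eta s else 0))"
      "swaps S' = (if eta s = weights S j \<and> i \<notin> active p (weights S) then swaps S + 1 else swaps S)"
      "swaps S' \<le> R"
    | (reset) i j where
      "away_update a p f L \<rho> g (iterate S) (weights S) i j s (iterate S') (weights S')" "swaps S' = 0"
proof -
  obtain i j \<eta> r where ij: "fw_vertex a p g i" "away_vertex a p g (weights S) j"
    and r: "r = (if \<eta> = weights S j \<and> i \<notin> active p (weights S) then swaps S + 1 else swaps S)"
    and cases: "if r \<le> R
         then direction s = a i - a j \<and> eta_max s = weights S j \<and> eta s = \<eta> \<and>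
              line_search f L \<rho> g (iterate S) (direction s) (eta_max s) (eta s) \<and>
              iterate S' = iterate S + eta s *\<^sub>R direction s \<and>
              weights S' = (\<lambda>k. weights S k + (if k = i then eta s else 0)
                                            - (if k = j then eta s else 0)) \<and>
              swaps S' = r
         else (\<exists>i' j'. away_update a p f L \<rho> g (iterate S) (weights S) i' j' s
                         (iterate S') (weights S')) \<and>
              swaps S' = 0"
    using assms unfolding pairwise_iteration_def by blast
  show thesis
  proof (cases "r \<le> R")
    case True
    then show thesis
      using cases by (intro pairwise[OF ij]) (auto simp: r)
  next
    case False
    then show thesis
      using cases reset by auto
  qed
qed

definition feasible ::
    "fw_alg \<Rightarrow> 'a::real_inner set \<Rightarrow> (nat \<Rightarrow> 'a) \<Rightarrow> nat \<Rightarrow> 'a fw_state \<Rightarrow> bool" where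
  "feasible alg C a p S \<longleftrightarrow>
     iterate S \<in> C \<and> (alg \<noteq> Vanilla \<longrightarrow> barycentric a p (weights S) (iterate S))"

text \<open>Each active vertex beyond the first can cause one later drop step, which costs 1. In the pairwise
algorithm a drop may also happen in the iteration that resets the swap counter, after which \<open>R\<close>
further swaps are possible; therefore such a vertex is worth \<open>R + 1\<close> there. The second summand
pays for the swaps that the counter still admits. It vanishes for a single active vertex, where
swaps have guaranteed decrease; without this exception the credit would start at \<open>R\<close> instead
of 0, and the bound on the number of iterations would be larger by \<open>R\<close>.\<close>

definition credit :: "fw_alg \<Rightarrow> nat \<Rightarrow> 'a fw_state \<Rightarrow> nat" where
  "credit alg p S = (let c = card (active p (weights S)) - 1 in
     case alg of Vanilla \<Rightarrow> 0 | Away_Step \<Rightarrow> c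
     | Pairwise R \<Rightarrow> (R + 1) * c + (if c = 0 then 0 else R - swaps S))"

text \<open>The largest growth of the credit in one step: one more active vertex, and, in the pairwise
algorithm, a swap counter that is reset from \<open>R\<close> to 0 or becomes relevant because a second vertex
becomes active.\<close>

definition gain :: "fw_alg \<Rightarrow> nat" where
  "gain alg = (case alg of Vanilla \<Rightarrow> 0 | Away_Step \<Rightarrow> 1 | Pairwise R \<Rightarrow> 2 * R + 1)"

lemma fw_factor_eq_gain: "fw_factor alg = real (gain alg) + 1"
  by (simp add: fw_factor_def gain_def split: fw_alg.split)

lemma barycentric_vertex:
  assumes "i \<le> p"
  shows "barycentric a p (\<lambda>k. if k = i then 1 else 0) (a i)"
  using assms by (simp add: barycentric_def if_distrib[of "\<lambda>c. c *\<^sub>R _"] cong: if_cong)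

lemma fw_init_feasible:
  assumes "fw_init alg C a p x0 S"
  shows "feasible alg C a p S" "credit alg p S = 0"
proof -
  show "feasible alg C a p S"
    using assms barycentric_vertex[of _ p a] by (auto simp: fw_init_def feasible_def)
  have "card (active p (weights S)) = 1" if nv: "alg \<noteq> Vanilla"
  proof -
    obtain i0 where "i0 \<le> p" "weights S = (\<lambda>j. if j = i0 then 1 else 0)"
      using assms nv by (auto simp: fw_init_def)
    then have "active p (weights S) = {i0}"
      by (auto simp: active_def)
    then show ?thesis
      by simp
  qed
  then show "credit alg p S = 0"
    by (cases alg) (simp_all add: credit_def)
qed

context
  fixes alg :: fw_alg and C :: "'a::real_inner set" and a :: "nat \<Rightarrow> 'a" and p :: nat
    and f :: "'a \<Rightarrow> real" and L \<rho> :: real and G :: "'a \<Rightarrow> 'a"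
    and S S' :: "'a fw_state" and s :: "'a fw_step"
  assumes C: "convex C" "alg \<noteq> Vanilla \<Longrightarrow> C = convex hull (a ` {0..p})"
    and S: "feasible alg C a p S"
    and step: "fw_iteration alg C a p f L \<rho> G S s S'"
begin

text \<open>The estimated gap in the test direction dominates the estimated Frank-Wolfe gap, so a successful
test bounds the latter; and the direction that is used has at least the gap of the test
direction, so a failed test makes the step substantial. In the pairwise algorithm the away part
of the direction contributes nonnegatively, as \<open>x\<close> is a convex combination of the active vertices.\<close>

lemma fw_iteration_test_direction:
  shows "y \<in> C \<Longrightarrow> - (G (iterate S) \<bullet> (y - iterate S)) \<le> - (G (iterate S) \<bullet> test_direction s)"
    and "- (G (iterate S) \<bullet> test_direction s) \<le> - (G (iterate S) \<bullet> direction s)"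
proof -
  define g where "g = G (iterate S)"
  define x where "x = iterate S"
  have "(y \<in> C \<longrightarrow> - (g \<bullet> (y - x)) \<le> - (g \<bullet> test_direction s)) \<and>
    - (g \<bullet> test_direction s) \<le> - (g \<bullet> direction s)"
  proof (cases alg)
    case Vanilla
    then show ?thesis
      using step by (auto simp: fw_iteration_def vanilla_iteration_def g_def x_def)
  next
    case Away_Step
    then obtain i j where up: "away_update a p f L \<rho> g x (weights S) i j s (iterate S') (weights S')"
      and t: "test_direction s = a i - x"
      using step by (auto simp: fw_iteration_def away_iteration_def g_def x_def)
    have "barycentric a p (weights S) x" "C = convex hull (a ` {0..p})"
      using S C Away_Step by (auto simp: feasible_def x_def)
    then show ?thesis
      using away_update_direction(2)[OF _ up] fw_vertex_minimizes_hull[of a p g i y] up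
      by (auto simp: t away_update_def inner_diff_right)
  next
    case (Pairwise R)
    then have bary: "barycentric a p (weights S) x" and hull: "C = convex hull (a ` {0..p})"
      using S C by (auto simp: feasible_def x_def)
    have t: "test_direction s = direction s"
      using step Pairwise by (simp add: fw_iteration_def pairwise_iteration_def)
    have "- (g \<bullet> (y - x)) \<le> - (g \<bullet> direction s)" if "y \<in> C"
    proof -
      consider i j where "fw_vertex a p g i" "away_vertex a p g (weights S) j" "direction s = a i - a j"
        | i j where "away_update a p f L \<rho> g x (weights S) i j s (iterate S') (weights S')"
        using step Pairwise
        by (auto simp: fw_iteration_def pairwise_iteration_def g_def x_def split: if_splits)
      then show ?thesis
      proof cases
        case 1
        then show ?thesis
          using away_vertex_ge[OF bary 1(2)] fw_vertex_minimizes_hull[of a p g i y] that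
          by (auto simp: hull inner_diff_right)
      next
        case 2
        then show ?thesis
          using away_update_direction(2)[OF bary 2] fw_vertex_minimizes_hull[of a p g i y] that
          by (auto simp: hull away_update_def inner_diff_right)
      qed
    qed
    then show ?thesis
      by (simp add: t)
  qed
  then show "y \<in> C \<Longrightarrow> - (G (iterate S) \<bullet> (y - iterate S)) \<le> - (G (iterate S) \<bullet> test_direction s)"
    "- (G (iterate S) \<bullet> test_direction s) \<le> - (G (iterate S) \<bullet> direction s)"
    by (simp_all add: g_def x_def)
qed

lemma fw_iteration_move:
  shows "line_search f L \<rho> (G (iterate S)) (iterate S) (direction s) (eta_max s) (eta s)"
    and "iterate S' = iterate S + eta s *\<^sub>R direction s"
    and "\<exists>u\<in>C. \<exists>v\<in>C. direction s = u - v"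
proof -
  define g where "g = G (iterate S)"
  define x where "x = iterate S"
  have "line_search f L \<rho> g x (direction s) (eta_max s) (eta s) \<and>
    iterate S' = x + eta s *\<^sub>R direction s \<and> (\<exists>u\<in>C. \<exists>v\<in>C. direction s = u - v)"
  proof -
    consider "alg = Vanilla"
      | i j where "alg \<noteq> Vanilla" "away_update a p f L \<rho> g x (weights S) i j s (iterate S') (weights S')"
      | i j where "alg \<noteq> Vanilla" "i \<le> p" "j \<le> p" "direction s = a i - a j"
        "line_search f L \<rho> g x (direction s) (eta_max s) (eta s)"
        "iterate S' = x + eta s *\<^sub>R direction s"
      using step
      by (auto simp: fw_iteration_def away_iteration_def pairwise_iteration_def g_def x_def
          fw_vertex_def away_vertex_def active_def split: fw_alg.splits if_splits)
    then show ?thesis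
    proof cases
      case 1
      then show ?thesis
        using step S
        by (auto simp: fw_iteration_def vanilla_iteration_def feasible_def g_def x_def)
    next
      case 2
      then show ?thesis
        using away_update_direction(1)[OF _ 2(2)] S C(2)
        by (auto simp: feasible_def x_def away_update_def)
    next
      case 3
        have "a i \<in> C" "a j \<in> C"
          using C(2) 3 by (auto intro: hull_inc)
        then show ?thesis
          using 3 by blast
    qed
  qed
  then show "line_search f L \<rho> (G (iterate S)) (iterate S) (direction s) (eta_max s) (eta s)"
    "iterate S' = iterate S + eta s *\<^sub>R direction s"
    "\<exists>u\<in>C. \<exists>v\<in>C. direction s = u - v"
    by (simp_all add: g_def x_def)
qed

lemma fw_iteration_feasible: "feasible alg C a p S'"
proof (cases "alg = Vanilla")
  case True
  then obtain y where y: "y \<in> C" "direction s = y - iterate S" "0 < eta s" "eta s \<le> 1"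
    using step by (auto simp: fw_iteration_def vanilla_iteration_def line_search_def)
  have "iterate S' = (1 - eta s) *\<^sub>R iterate S + eta s *\<^sub>R y"
    by (simp add: fw_iteration_move(2) y algebra_simps)
  also have "\<dots> \<in> C"
    using C(1) S y by (intro convexD) (auto simp: feasible_def)
  finally show ?thesis
    using True by (simp add: feasible_def)
next
  case False
  then have bary: "barycentric a p (weights S) (iterate S)" and hull: "C = convex hull (a ` {0..p})"
    using S C by (auto simp: feasible_def)
  have "barycentric a p (weights S') (iterate S')"
  proof (cases alg)
    case (Pairwise R)
    then have "pairwise_iteration R a p f L \<rho> (G (iterate S)) S s S'"
      using step by (simp add: fw_iteration_def)
    then show ?thesis
    proof (cases rule: pairwise_iteration_cases)
      case (pairwise i j)
      then show ?thesis
        using barycentric_pairwise[OF bary, of i j "eta s"]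
        by (simp add: fw_vertex_def away_vertex_def active_def line_search_def)
    qed (rule away_update_barycentric[OF bary])
  qed (use step False away_update_barycentric[OF bary] in
      \<open>auto simp: fw_iteration_def away_iteration_def\<close>)
  then show ?thesis
    using barycentric_in_hull hull by (auto simp: feasible_def)
qed

text \<open>The positive gap matters for pairwise directions only: it makes the two vertices distinct. A
pairwise step of full length below 1 then either drops the away vertex (if the Frank-Wolfe vertex is
already active) or is a swap that keeps the number of active vertices and increases the counter.\<close>

lemma fw_iteration_credit:
  assumes gap: "0 < - (G (iterate S) \<bullet> direction s)"
  shows "guaranteed L (G (iterate S)) s \<Longrightarrow> credit alg p S' \<le> credit alg p S + gain alg"
    and "\<not> guaranteed L (G (iterate S)) s \<Longrightarrow> credit alg p S' < credit alg p S"
proof -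
  define g where "g = G (iterate S)"
  define c c' where "c = card (active p (weights S))" and "c' = card (active p (weights S'))"
  have "(guaranteed L g s \<longrightarrow> credit alg p S' \<le> credit alg p S + gain alg) \<and>
    (\<not> guaranteed L g s \<longrightarrow> credit alg p S' < credit alg p S)"
  proof (cases alg)
    case Vanilla
    then show ?thesis
      using step
      by (auto simp: fw_iteration_def vanilla_iteration_def guaranteed_def credit_def gain_def)
  next
    case Away_Step
    then obtain i j where up:
      "away_update a p f L \<rho> g (iterate S) (weights S) i j s (iterate S') (weights S')"
      using step by (auto simp: fw_iteration_def away_iteration_def g_def)
    have bary: "barycentric a p (weights S) (iterate S)"
      using S Away_Step by (simp add: feasible_def)
    have "0 < c'"
      using active_nonempty[OF away_update_barycentric[OF bary up]] by (simp add: c'_def)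
    moreover have "c' \<le> c + 1" "\<not> guaranteed L g s \<Longrightarrow> c' < c"
      using away_update_card_active[OF bary up] away_update_drop[OF bary up]
      by (simp_all add: c_def c'_def)
    ultimately show ?thesis
      by (auto simp: Away_Step credit_def gain_def simp flip: c_def c'_def)
  next
    case (Pairwise R)
    have bary: "barycentric a p (weights S) (iterate S)"
        "barycentric a p (weights S') (iterate S')"
      using S fw_iteration_feasible Pairwise by (simp_all add: feasible_def)
    then obtain u u' where u: "c = Suc u" "c' = Suc u'"
      using active_nonempty c_def c'_def by (metis gr0_implies_Suc)
    have credits: "credit alg p S = (R + 1) * u + (if u = 0 then 0 else R - swaps S)"
        "credit alg p S' = (R + 1) * u' + (if u' = 0 then 0 else R - swaps S')"
      using u by (simp_all add: Pairwise credit_def flip: c_def c'_def)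
    \<comment> \<open>The new credit is at most \<open>(R + 1) * (u + 1) + R\<close>, whatever the counter is.\<close>
    have good: "credit alg p S' \<le> credit alg p S + gain alg" if "c' \<le> c + 1"
    proof -
      have "(R + 1) * u' \<le> (R + 1) * (u + 1)"
        using that u by (intro mult_le_mono2) simp
      then show ?thesis
        unfolding credits by (cases "u = 0") (auto simp: Pairwise gain_def)
    qed
    \<comment> \<open>The \<open>R + 1\<close> of the dropped vertex covers the cost 1 and the \<open>R\<close> swaps after a reset.\<close>
    have drop: "credit alg p S' < credit alg p S" if "c' < c" "swaps S' = 0 \<or> swaps S' = swaps S"
    proof -
      have "(R + 1) * (u' + 1) \<le> (R + 1) * u"
        using that(1) u by (intro mult_le_mono2) simp
      then show ?thesis
        using that u by (auto simp: credits)
    qed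
    have "pairwise_iteration R a p f L \<rho> g S s S'"
      using step Pairwise by (simp add: fw_iteration_def g_def)
    then show ?thesis
    proof (cases rule: pairwise_iteration_cases)
      case (pairwise i j)
      have "i \<noteq> j"
        using gap pairwise(3) by auto
      have j: "j \<in> active p (weights S)"
        using pairwise(2) by (simp add: away_vertex_def)
      have eta: "0 < eta s" "eta s \<le> weights S j"
        using pairwise(4,5) by (simp_all add: line_search_def)
      note sub = active_pairwise_subset[OF pairwise(7) less_imp_le[OF eta(1)], of p]
      have "c' \<le> card (insert i (active p (weights S)))"
        unfolding c'_def by (intro card_mono sub(1)) simp
      then have "c' \<le> c + 1"
        by (auto simp: c_def card_insert_if split: if_splits)
      moreover have "credit alg p S' < credit alg p S" if "\<not> guaranteed L g s"
      proof -
        have full: "eta s = weights S j" "weights S j < 1"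
          using that pairwise(4,5) by (auto simp: guaranteed_def line_search_def)
        have "c' \<le> card (insert i (active p (weights S) - {j}))"
          unfolding c'_def using full \<open>i \<noteq> j\<close> by (intro card_mono sub(2)) simp_all
        moreover have "card (active p (weights S) - {j}) = c - 1"
          using j by (simp add: c_def)
        ultimately have c': "c' \<le> (if i \<in> active p (weights S) then c - 1 else c)"
          using \<open>i \<noteq> j\<close> u by (auto simp: card_insert_if split: if_splits)
        have "2 \<le> c"
          using card_active_ge_2[OF bary(1) j full(2)] by (simp add: c_def)
        show ?thesis
        proof (cases "i \<in> active p (weights S)")
          case True
          then show ?thesis
            using c' \<open>2 \<le> c\<close> pairwise(8) by (intro drop) auto
        next
          case False
          then have "swaps S' = swaps S + 1"
            using pairwise(8) full by simp
          moreover have "(R + 1) * u' \<le> (R + 1) * u"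
            using c' False u by (intro mult_le_mono2) simp
          ultimately show ?thesis
            using pairwise(9) \<open>2 \<le> c\<close> u by (auto simp: credits)
        qed
      qed
      ultimately show ?thesis
        using good by blast
    next
      case (reset i j)
      then show ?thesis
        using away_update_card_active[OF bary(1) reset(1)] away_update_drop[OF bary(1) reset(1)]
          good drop by (auto simp: c_def c'_def)
    qed
  qed
  then show "guaranteed L (G (iterate S)) s \<Longrightarrow> credit alg p S' \<le> credit alg p S + gain alg"
    "\<not> guaranteed L (G (iterate S)) s \<Longrightarrow> credit alg p S' < credit alg p S"
    by (simp_all add: g_def)
qed

end

section \<open>Counting iterations\<close>

text \<open>Strictness survives the steps without decrease because the first step cannot be one of them: the
potential starts at 0 and could not shrink.\<close>

lemma amortized_count:
  fixes F :: "nat \<Rightarrow> real" and \<Psi> :: "nat \<Rightarrow> nat"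
  assumes "0 < \<delta>" "\<Psi> 0 = 0" "0 < n"
    and "\<And>i. i < n \<Longrightarrow> \<delta> < F i - F (Suc i) \<and> \<Psi> (Suc i) \<le> \<Psi> i + K \<or>
      F (Suc i) \<le> F i \<and> \<Psi> (Suc i) < \<Psi> i"
  shows "\<delta> * real (n + \<Psi> n) < (real K + 1) * (F 0 - F n)"
  using assms(3,4)
proof (induction n)
  case (Suc n)
  have before: "\<delta> * real (n + \<Psi> n) \<le> (real K + 1) * (F 0 - F n)"
    using Suc.IH Suc.prems(2) assms(2) by (cases "n = 0") (auto intro: less_imp_le)
  show ?case
  proof (cases "\<delta> < F n - F (Suc n) \<and> \<Psi> (Suc n) \<le> \<Psi> n + K")
    case True
    then have "\<delta> * real (Suc n + \<Psi> (Suc n)) \<le> \<delta> * (real (n + \<Psi> n) + (real K + 1))"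
      using assms(1) by (intro mult_left_mono) auto
    also have "\<dots> \<le> (real K + 1) * (F 0 - F n) + (real K + 1) * \<delta>"
      using before by (simp add: algebra_simps)
    also have "\<dots> < (real K + 1) * (F 0 - F n) + (real K + 1) * (F n - F (Suc n))"
      using True by (intro add_strict_left_mono mult_strict_left_mono) auto
    finally show ?thesis
      by (simp add: algebra_simps)
  next
    case False
    then have drop: "F (Suc n) \<le> F n" "\<Psi> (Suc n) < \<Psi> n"
      using Suc.prems(2)[of n] by auto
    then have "n \<noteq> 0"
      using assms(2) by (cases n) auto
    have "\<delta> * real (Suc n + \<Psi> (Suc n)) \<le> \<delta> * real (n + \<Psi> n)"
      using drop(2) assms(1) by (intro mult_left_mono) auto
    also have "\<dots> < (real K + 1) * (F 0 - F n)"
      using Suc.IH Suc.prems(2) \<open>n \<noteq> 0\<close> by simp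
    also have "\<dots> \<le> (real K + 1) * (F 0 - F (Suc n))"
      using drop(1) by (intro mult_left_mono) auto
    finally show ?thesis .
  qed
qed simp

lemma fw_feasible:
  assumes "convex C" "alg \<noteq> Vanilla \<Longrightarrow> C = convex hull (a ` {0..p})"
    and "fw_init alg C a p x0 (S 0)"
    and "\<And>i. i < n \<Longrightarrow> fw_iteration alg C a p f L \<rho> G (S i) (s i) (S (Suc i))"
  shows "feasible alg C a p (S n)"
  using assms(4)
proof (induction n)
  case 0
  then show ?case
    using fw_init_feasible(1)[OF assms(3)] by simp
next
  case (Suc n)
  then show ?case
    using fw_iteration_feasible[OF assms(1,2)] by (metis less_Suc_eq)
qed

lemma fw_iteration_count:
  fixes C :: "'a::euclidean_space set"
  assumes C: "compact C" "convex C" "alg \<noteq> Vanilla \<Longrightarrow> C = convex hull (a ` {0..p})"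
    and f: "\<And>x. GDERIV f x :> grad f x" and L: "L-lipschitz_on UNIV (grad f)" "0 < L"
    and \<rho>: "0 < \<rho>" and \<Delta>: "0 < diameter C"
    and err: "\<And>x. x \<in> C \<Longrightarrow> norm (G x - grad f x) * diameter C \<le> e"
    and \<gamma>: "0 < \<gamma>" "e < \<gamma> / 2"
    and init: "fw_init alg C a p x0 (S 0)"
    and iter: "\<And>i. i < n \<Longrightarrow> fw_iteration alg C a p f L \<rho> G (S i) (s i) (S (Suc i))"
    and gap: "\<And>i. i < n \<Longrightarrow> \<gamma> < - (G (iterate (S i)) \<bullet> direction (s i))"
    and n: "0 < n" and low: "\<And>x. x \<in> C \<Longrightarrow> low \<le> f x"
  shows "real n < fw_factor alg *
    ((f x0 - low) / min (\<rho> * \<gamma>\<^sup>2 / (L * (diameter C)\<^sup>2)) (\<gamma> / 2 - e))"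
proof -
  define \<delta> where "\<delta> = min (\<rho> * \<gamma>\<^sup>2 / (L * (diameter C)\<^sup>2)) (\<gamma> / 2 - e)"
  define F where "F = (\<lambda>i. f (iterate (S i)))"
  have \<delta>: "0 < \<delta>"
    using \<rho> \<gamma> L(2) \<Delta> by (simp add: \<delta>_def)
  have feas: "feasible alg C a p (S i)" if "i \<le> n" for i
    using that iter
    by (intro fw_feasible[where S = S and s = s and f = f and L = L and \<rho> = \<rho> and G = G,
        OF C(2,3) init]) auto
  have "F 0 = f x0"
    using init by (simp add: F_def fw_init_def)
  moreover have "\<delta> * real (n + credit alg p (S n)) < (real (gain alg) + 1) * (F 0 - F n)"
  proof (rule amortized_count[OF \<delta> _ n])
    show "credit alg p (S 0) = 0"
      by (rule fw_init_feasible(2)[OF init])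
    fix i assume i: "i < n"
    then have step: "feasible alg C a p (S i)"
        "fw_iteration alg C a p f L \<rho> G (S i) (s i) (S (Suc i))"
      using feas iter by auto
    note move = fw_iteration_move[OF C(2,3) step]
    obtain u v where "u \<in> C" "v \<in> C" "direction (s i) = u - v"
      using move(3) by blast
    then have d: "norm (direction (s i)) \<le> diameter C"
      using diameter_bounded_bound[OF compact_imp_bounded[OF C(1)]] by (simp add: dist_norm)
    have e: "norm (G (iterate (S i)) - grad f (iterate (S i))) * diameter C \<le> e"
      using err step(1) by (simp add: feasible_def)
    have pos: "0 < - (G (iterate (S i)) \<bullet> direction (s i))"
      using gap[OF i] \<gamma> by linarith
    show "\<delta> < F i - F (Suc i) \<and> credit alg p (S (Suc i)) \<le> credit alg p (S i) + gain alg \<or>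
      F (Suc i) \<le> F i \<and> credit alg p (S (Suc i)) < credit alg p (S i)"
    proof (cases "guaranteed L (G (iterate (S i))) (s i)")
      case True
      then show ?thesis
        using guaranteed_decrease[OF f L move(1) \<rho> True e d gap[OF i] \<gamma>]
          fw_iteration_credit(1)[OF C(2,3) step pos] by (simp add: F_def \<delta>_def move(2))
    next
      case False
      then show ?thesis
        using line_search_nonincreasing[OF move(1) less_imp_le[OF pos] L(2) \<rho>]
          fw_iteration_credit(2)[OF C(2,3) step pos] by (simp add: F_def move(2))
    qed
  qed
  ultimately have "\<delta> * real (n + credit alg p (S n)) < (real (gain alg) + 1) * (f x0 - F n)"
    by simp
  moreover have "low \<le> F n"
    using low feas[of n] by (simp add: F_def feasible_def)
  then have "(real (gain alg) + 1) * (f x0 - F n) \<le> (real (gain alg) + 1) * (f x0 - low)"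
    by (intro mult_left_mono) auto
  moreover have "\<delta> * real n \<le> \<delta> * real (n + credit alg p (S n))"
    using \<delta> by (intro mult_left_mono) auto
  ultimately have "\<delta> * real n < fw_factor alg * (f x0 - low)"
    unfolding fw_factor_eq_gain by linarith
  then have "real n < fw_factor alg * (f x0 - low) / \<delta>"
    using \<delta> by (simp add: pos_less_divide_eq mult.commute)
  then show ?thesis
    by (simp add: \<delta>_def)
qed

text \<open>The constants \<open>\<alpha>\<^sub>1\<close> and \<open>\<alpha>\<^sub>2\<close> are the total possible decrease divided by the two terms of the decrease
per step; note \<open>\<gamma> / 2 - e = \<tau> (1 - 3 \<sigma>) / (2 (1 + \<sigma>))\<close>, which is where \<open>\<sigma> < 1 / 3\<close> is needed.\<close>

lemma iter_bound_eq:
  fixes C :: "'a::real_inner set"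
  assumes "0 \<le> \<sigma>" "\<sigma> < 1 / 3" "0 < \<tau>" "0 < \<rho>" "0 < L" "0 < diameter C" 
    and h: "(INF x\<in>C. f x) \<le> f x0"
    and \<gamma>: "\<gamma> = \<tau> * (1 - \<sigma>) / (1 + \<sigma>)" and e: "e = \<sigma> / (1 + \<sigma>) * \<tau>"
  shows "iter_bound alg C f L \<rho> \<sigma> x0 \<tau> = \<lceil>fw_factor alg *
    ((f x0 - (INF x\<in>C. f x)) / min (\<rho> * \<gamma>\<^sup>2 / (L * (diameter C)\<^sup>2)) (\<gamma> / 2 - e))\<rceil> - 1"
proof -
  define h where "h = f x0 - (INF x\<in>C. f x)"
  have pos: "0 < 1 + \<sigma>" "0 < 1 - \<sigma>" "0 < 1 - 3 * \<sigma>"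
    using assms by auto
  have h: "0 \<le> h"
    using assms(7) by (simp add: h_def)
  have max_div: "max (h / b) (h / c) = h / min b c" if "0 < b" "0 < c" for b c
  proof (cases "b \<le> c")
    case True
    then show ?thesis
      using h that by (simp add: max_absorb1 frac_le)
  next
    case False
    then show ?thesis
      using h that by (simp add: max_absorb2 frac_le)
  qed
  have 1: "(diameter C)\<^sup>2 * L * h * (1 + \<sigma>)\<^sup>2 / (\<tau>\<^sup>2 * \<rho> * (1 - \<sigma>)\<^sup>2)
      = h / (\<rho> * \<gamma>\<^sup>2 / (L * (diameter C)\<^sup>2))"
    by (simp add: \<gamma> power_divide power_mult_distrib mult_ac)
  have "\<gamma> / 2 - e = \<tau> * (1 - 3 * \<sigma>) / (2 * (1 + \<sigma>))"
    using pos by (simp add: \<gamma> e divide_simps) (simp add: algebra_simps)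
  then have 2: "2 * h * (1 + \<sigma>) / (\<tau> * (1 - 3 * \<sigma>)) = h / (\<gamma> / 2 - e)" and "0 < \<gamma> / 2 - e"
    using assms pos by (simp_all add: mult_ac)
  moreover have "0 < \<rho> * \<gamma>\<^sup>2 / (L * (diameter C)\<^sup>2)"
    using assms pos by (simp add: \<gamma>)
  ultimately show ?thesis
    by (simp only: iter_bound_def Let_def h_def[symmetric] 1 2 max_div)
qed

lemma fw_gap_le:
  assumes "C \<noteq> {}" "\<And>y. y \<in> C \<Longrightarrow> - (grad f x \<bullet> (y - x)) \<le> b"
  shows "fw_gap C f x \<le> b"
proof -
  have "- b \<le> (INF y\<in>C. grad f x \<bullet> (y - x))"
    using assms by (intro cINF_greatest) force+
  then show ?thesis
    by (simp add: fw_gap_def)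
qed

lemma estimated_gap_error:
  fixes C :: "'a::euclidean_space set"
  assumes "bounded C" "x \<in> C" "y \<in> C" "norm (g - grad f x) * diameter C \<le> e"
  shows "- (grad f x \<bullet> (y - x)) \<le> - (g \<bullet> (y - x)) + e"
proof -
  have "(g - grad f x) \<bullet> (y - x) \<le> norm (g - grad f x) * norm (y - x)"
    by (rule norm_cauchy_schwarz)
  also have "\<dots> \<le> norm (g - grad f x) * diameter C"
    using diameter_bounded_bound[OF assms(1,3,2)]
    by (intro mult_left_mono) (auto simp: dist_norm)
  finally show ?thesis
    using assms(4) by (simp add: inner_diff_left)
qed


context
  fixes alg :: fw_alg and C :: "'a::euclidean_space set" and a :: "nat \<Rightarrow> 'a" and p :: nat
    and f :: "'a \<Rightarrow> real" and L \<rho> \<sigma> \<tau> :: real and G :: "'a \<Rightarrow> 'a"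
  assumes C: "compact C" "convex C" "alg \<noteq> Vanilla \<Longrightarrow> C = convex hull (a ` {0..p})"
    and \<Delta>: "0 < diameter C"
    and f: "\<And>x. GDERIV f x :> grad f x" and L: "L-lipschitz_on UNIV (grad f)" "0 < L"
    and \<rho>: "0 < \<rho>" and \<sigma>: "0 \<le> \<sigma>" "\<sigma> < 1 / 3" and \<tau>: "0 < \<tau>"
    and err: "\<And>x. x \<in> C \<Longrightarrow> norm (G x - grad f x) * diameter C \<le> \<sigma> / (1 + \<sigma>) * \<tau>"
begin

text \<open>The count is strict, \<open>n < y\<close> with \<open>y = \<kappa> max \<alpha>\<^sub>1 \<alpha>\<^sub>2\<close>, and thus yields \<open>\<lceil>y\<rceil> - 1\<close> instead of \<open>\<lceil>y\<rceil>\<close>. The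
assumption \<open>0 < n\<close> cannot be dropped: for a minimal starting value the bound is \<open>-1\<close>.\<close>

lemma unsolved_iterations_le:
  assumes init: "fw_init alg C a p x0 (S 0)"
    and iter: "\<And>i. i < n \<Longrightarrow> fw_iteration alg C a p f L \<rho> G (S i) (s i) (S (Suc i))"
    and gap: "\<And>i. i < n \<Longrightarrow>
      \<tau> * (1 - \<sigma>) / (1 + \<sigma>) < - (G (iterate (S i)) \<bullet> direction (s i))"
    and n: "0 < n"
  shows "int n \<le> iter_bound alg C f L \<rho> \<sigma> x0 \<tau>"
proof -
  define \<gamma> where "\<gamma> = \<tau> * (1 - \<sigma>) / (1 + \<sigma>)"
  define e where "e = \<sigma> / (1 + \<sigma>) * \<tau>"
  have "continuous_on C f"
    using f by (intro continuous_at_imp_continuous_on ballI)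
      (auto simp: gderiv_def intro: has_derivative_continuous)
  then have "bdd_below (f ` C)"
    using C(1) by (intro bounded_imp_bdd_below compact_imp_bounded compact_continuous_image)
  then have low: "(INF x\<in>C. f x) \<le> f x" if "x \<in> C" for x
    using that by (rule cINF_lower)
  have "\<gamma> / 2 - e = \<tau> * (1 - 3 * \<sigma>) / (2 * (1 + \<sigma>))"
    using \<sigma> by (simp add: \<gamma>_def e_def divide_simps) (simp add: algebra_simps)
  also have "0 < \<dots>"
    using \<sigma> \<tau> by simp
  finally have "0 < \<gamma>" "e < \<gamma> / 2"
    using \<sigma> \<tau> by (simp_all add: \<gamma>_def)
  then have "real n < fw_factor alg * ((f x0 - (INF x\<in>C. f x)) /
      min (\<rho> * \<gamma>\<^sup>2 / (L * (diameter C)\<^sup>2)) (\<gamma> / 2 - e))"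
    using fw_iteration_count[where S = S and s = s and G = G and n = n and e = e and \<gamma> = \<gamma>
        and low = "INF x\<in>C. f x", OF C f L \<rho> \<Delta>] err init iter gap n low
    by (simp add: \<gamma>_def e_def)
  moreover have "x0 \<in> C"
    using init by (simp add: fw_init_def)
  ultimately show ?thesis
    using iter_bound_eq[OF \<sigma> \<tau> \<rho> L(2) \<Delta> low \<gamma>_def e_def, of x0 alg] by linarith
qed

lemma fw_run_terminates:
  assumes run: "fw_run alg C a p f L \<rho> G \<tau> x0 S s"
  shows "\<exists>N. fw_terminates_at G \<tau> S s N \<and> N \<le> nat (iter_bound alg C f L \<rho> \<sigma> x0 \<tau>) \<and>
    best_gap C f S N \<le> \<tau> / (1 + \<sigma>) * (1 + 2 * \<sigma>)"
proof -
  define N\<^sub>0 where "N\<^sub>0 = nat (iter_bound alg C f L \<rho> \<sigma> x0 \<tau>)"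
  have init: "fw_init alg C a p x0 (S 0)"
    and iter: "\<And>n. (\<And>i. i < n \<Longrightarrow> \<not> fw_stops G \<tau> S s i) \<Longrightarrow>
      fw_iteration alg C a p f L \<rho> G (S n) (s n) (S (Suc n))"
    using run by (auto simp: fw_run_def)
  have feas: "feasible alg C a p (S n)" if "\<And>i. i < n \<Longrightarrow> \<not> fw_stops G \<tau> S s i" for n
    using that iter
    by (intro fw_feasible[where S = S and s = s and f = f and L = L and \<rho> = \<rho> and G = G,
        OF C(2,3) init]) auto
  have count: "n \<le> N\<^sub>0" if ns: "\<And>i. i < n \<Longrightarrow> \<not> fw_stops G \<tau> S s i" for n
  proof (cases "n = 0")
    case False
    have "int n \<le> iter_bound alg C f L \<rho> \<sigma> x0 \<tau>"
    proof (rule unsolved_iterations_le[where S = S and s = s, OF init])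
      fix i assume i: "i < n"
      then have ns_i: "\<And>k. k < i \<Longrightarrow> \<not> fw_stops G \<tau> S s k"
        using ns by auto
      show step: "fw_iteration alg C a p f L \<rho> G (S i) (s i) (S (Suc i))"
        using iter ns_i by blast
      have "\<tau> * (1 - \<sigma>) / (1 + \<sigma>) \<le> \<tau>"
        using \<sigma> \<tau> by (simp add: field_simps)
      also have "\<tau> < - (G (iterate (S i)) \<bullet> test_direction (s i))"
        using ns[OF i] by (simp add: fw_stops_def)
      also have "\<dots> \<le> - (G (iterate (S i)) \<bullet> direction (s i))"
        using fw_iteration_test_direction(2)[OF C(2,3) feas step] ns_i by blast
      finally show "\<tau> * (1 - \<sigma>) / (1 + \<sigma>) < - (G (iterate (S i)) \<bullet> direction (s i))" .
    qed (use False in simp)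
    then show ?thesis
      by (simp add: N\<^sub>0_def)
  qed simp
  have "\<exists>n. fw_stops G \<tau> S s n"
    using count[of "Suc N\<^sub>0"] by auto
  then obtain N where N: "fw_stops G \<tau> S s N" "\<And>n. n < N \<Longrightarrow> \<not> fw_stops G \<tau> S s n"
    using exists_least_iff[of "fw_stops G \<tau> S s"] by blast
  have x: "iterate (S N) \<in> C"
    using feas[OF N(2)] by (simp add: feasible_def)
  have "best_gap C f S N \<le> fw_gap C f (iterate (S N))"
    unfolding best_gap_def by (rule Min_le) auto
  also have "\<dots> \<le> \<tau> + \<sigma> / (1 + \<sigma>) * \<tau>"
  proof (rule fw_gap_le)
    fix y assume y: "y \<in> C"
    have "- (grad f (iterate (S N)) \<bullet> (y - iterate (S N)))
        \<le> - (G (iterate (S N)) \<bullet> (y - iterate (S N))) + \<sigma> / (1 + \<sigma>) * \<tau>"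
      by (rule estimated_gap_error[OF compact_imp_bounded[OF C(1)] x y err[OF x]])
    also have "- (G (iterate (S N)) \<bullet> (y - iterate (S N)))
        \<le> - (G (iterate (S N)) \<bullet> test_direction (s N))"
      by (rule fw_iteration_test_direction(1)[OF C(2,3) feas[OF N(2)] iter[OF N(2)] y])
    also have "\<dots> \<le> \<tau>"
      using N(1) by (simp add: fw_stops_def)
    finally show "- (grad f (iterate (S N)) \<bullet> (y - iterate (S N))) \<le> \<tau> + \<sigma> / (1 + \<sigma>) * \<tau>"
      by simp
  qed (use x in auto)
  also have "\<dots> = \<tau> / (1 + \<sigma>) * (1 + 2 * \<sigma>)"
    using \<sigma> by (simp add: divide_simps) (simp add: algebra_simps)
  finally show ?thesis
    using N count[OF N(2)] by (auto simp: fw_terminates_at_def N\<^sub>0_def)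
qed

text \<open>If all \<open>N + 1\<close> gaps were larger than \<open>\<tau> / (1 + \<sigma>)\<close>, then all \<open>N + 1\<close> iterations would count as
unsolved ones, one more than the bound permits.\<close>

lemma fw_performs_best_gap:
  assumes "fw_performs alg C a p f L \<rho> G x0 S s N" "iter_bound alg C f L \<rho> \<sigma> x0 \<tau> \<le> int N"
  shows "best_gap C f S N \<le> \<tau> / (1 + \<sigma>)"
proof (rule ccontr)
  assume "\<not> best_gap C f S N \<le> \<tau> / (1 + \<sigma>)"
  then have large: "\<tau> / (1 + \<sigma>) < fw_gap C f (iterate (S i))" if "i \<le> N" for i
  proof -
    have "best_gap C f S N \<le> fw_gap C f (iterate (S i))"
      unfolding best_gap_def using that by (intro Min_le) auto
    with \<open>\<not> best_gap C f S N \<le> \<tau> / (1 + \<sigma>)\<close> show ?thesis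
      by linarith
  qed
  have init: "fw_init alg C a p x0 (S 0)"
    and iter: "\<And>i. i \<le> N \<Longrightarrow> fw_iteration alg C a p f L \<rho> G (S i) (s i) (S (Suc i))"
    using assms(1) by (auto simp: fw_performs_def)
  have "int (Suc N) \<le> iter_bound alg C f L \<rho> \<sigma> x0 \<tau>"
  proof (rule unsolved_iterations_le[where S = S and s = s, OF init])
    fix i assume "i < Suc N"
    then have i: "i \<le> N"
      by simp
    show step: "fw_iteration alg C a p f L \<rho> G (S i) (s i) (S (Suc i))"
      by (rule iter[OF i])
    have feas: "feasible alg C a p (S i)"
      using i iter
      by (intro fw_feasible[where S = S and s = s and f = f and L = L and \<rho> = \<rho> and G = G,
          OF C(2,3) init]) auto
    then have x: "iterate (S i) \<in> C"
      by (simp add: feasible_def)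
    obtain y where y: "y \<in> C" "\<tau> / (1 + \<sigma>) < - (grad f (iterate (S i)) \<bullet> (y - iterate (S i)))"
      using fw_gap_le[of C f "iterate (S i)" "\<tau> / (1 + \<sigma>)"] large[OF i] x by force
    have "\<tau> * (1 - \<sigma>) / (1 + \<sigma>) = \<tau> / (1 + \<sigma>) - \<sigma> / (1 + \<sigma>) * \<tau>"
      using \<sigma> by (simp add: divide_simps) (simp add: algebra_simps)
    also have "\<dots> < - (G (iterate (S i)) \<bullet> (y - iterate (S i)))"
      using estimated_gap_error[OF compact_imp_bounded[OF C(1)] x y(1) err[OF x]] y(2) by linarith
    also have "\<dots> \<le> - (G (iterate (S i)) \<bullet> test_direction (s i))"
      by (rule fw_iteration_test_direction(1)[OF C(2,3) feas step y(1)])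
    also have "\<dots> \<le> - (G (iterate (S i)) \<bullet> direction (s i))"
      by (rule fw_iteration_test_direction(2)[OF C(2,3) feas step])
    finally show "\<tau> * (1 - \<sigma>) / (1 + \<sigma>) < - (G (iterate (S i)) \<bullet> direction (s i))" .
  qed simp
  then show False
    using assms(2) by simp
qed

end

section \<open>Order of the bounds as the tolerance tends to zero\<close>

text \<open>Both bounds are stated with 1 added, so that their product also dominates the total number of
iterations, where the initial iteration and the upper-level iterations are counted too.\<close>

lemma iter_bound_bigo:
  "(\<lambda>\<tau>. 1 + \<bar>real_of_int (iter_bound alg C f L \<rho> \<sigma> x0 \<tau>)\<bar>) \<in> O[at_right 0](\<lambda>\<tau>. 1 / \<tau>\<^sup>2)"
proof -
  define h where "h = f x0 - (INF x\<in>C. f x)"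
  define A1 where "A1 = (diameter C)\<^sup>2 * L * h * (1 + \<sigma>)\<^sup>2 / (\<rho> * (1 - \<sigma>)\<^sup>2)"
  define A2 where "A2 = 2 * h * (1 + \<sigma>) / (1 - 3 * \<sigma>)"
  define k where "k = fw_factor alg"
  have k: "0 \<le> k"
    by (simp add: k_def fw_factor_eq_gain)
  have bound: "1 + \<bar>real_of_int (iter_bound alg C f L \<rho> \<sigma> x0 \<tau>)\<bar> \<le> (2 + k * (\<bar>A1\<bar> + \<bar>A2\<bar>)) * (1 / \<tau>\<^sup>2)"
    if \<tau>: "0 < \<tau>" "\<tau> < 1" for \<tau> :: real
  proof -
    have sq: "\<tau>\<^sup>2 \<le> \<tau>" "\<tau>\<^sup>2 \<le> 1" "0 < \<tau>\<^sup>2"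
      using \<tau> by (auto simp: power2_eq_square mult_le_one)
    have "iter_bound alg C f L \<rho> \<sigma> x0 \<tau> = \<lceil>k * max (A1 / \<tau>\<^sup>2) (A2 / \<tau>)\<rceil> - 1"
      unfolding iter_bound_def Let_def h_def[symmetric] k_def[symmetric]
      by (simp add: A1_def A2_def mult_ac)
    moreover have "1 + \<bar>real_of_int (\<lceil>y\<rceil> - 1)\<bar> \<le> 2 + \<bar>y\<bar>" for y :: real
      by linarith
    ultimately have "1 + \<bar>real_of_int (iter_bound alg C f L \<rho> \<sigma> x0 \<tau>)\<bar>
        \<le> 2 + \<bar>k * max (A1 / \<tau>\<^sup>2) (A2 / \<tau>)\<bar>"
      by simp
    moreover have "\<bar>k * max y z\<bar> \<le> k * (\<bar>y\<bar> + \<bar>z\<bar>)" for y z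
      unfolding abs_mult abs_of_nonneg[OF k] by (intro mult_left_mono k) auto
    moreover have "\<bar>A1 / \<tau>\<^sup>2\<bar> + \<bar>A2 / \<tau>\<bar> \<le> (\<bar>A1\<bar> + \<bar>A2\<bar>) * (1 / \<tau>\<^sup>2)"
      using \<tau> sq by (simp add: abs_divide add_divide_distrib frac_le)
    then have "k * (\<bar>A1 / \<tau>\<^sup>2\<bar> + \<bar>A2 / \<tau>\<bar>) \<le> k * ((\<bar>A1\<bar> + \<bar>A2\<bar>) * (1 / \<tau>\<^sup>2))"
      using k by (rule mult_left_mono)
    moreover have "2 \<le> 2 * (1 / \<tau>\<^sup>2)"
      using sq by (simp add: divide_simps)
    ultimately show ?thesis
      unfolding distrib_right mult.assoc by (meson add_mono order_trans)
  qed
  show ?thesis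
  proof (rule bigoI)
    show "\<forall>\<^sub>F \<tau> in at_right 0. norm (1 + \<bar>real_of_int (iter_bound alg C f L \<rho> \<sigma> x0 \<tau>)\<bar>)
        \<le> (2 + k * (\<bar>A1\<bar> + \<bar>A2\<bar>)) * norm (1 / \<tau>\<^sup>2)"
      using bound by (intro eventually_at_rightI[of 0 1]) simp_all
  qed
qed

lemma scheme_iters_bigo:
  assumes "0 < q" "q < 1" "\<And>\<epsilon>. m = ITD \<epsilon> \<Longrightarrow> 0 < \<epsilon> \<and> \<epsilon> < 1"
    and "0 < \<sigma>" "0 < \<Delta>" "0 < M"
  shows "(\<lambda>\<tau>. 1 + real (the_enat (scheme_iters m \<sigma> \<tau> \<Delta> M q))) \<in> O[at_right 0](\<lambda>\<tau>. ln (1 / \<tau>))"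
proof -
  define r where "r = scheme_rate m q"
  define B where "B = \<sigma> / ((1 + \<sigma>) * \<Delta> * M) / scheme_factor m q"
  define c where "c = 2 + \<bar>ln B / ln r\<bar> + \<bar>1 / ln r\<bar>"
  have B: "0 < B"
    using assms scheme_factor_pos[OF assms(1-3)] by (simp add: B_def)
  have bound: "1 + real (the_enat (scheme_iters m \<sigma> \<tau> \<Delta> M q)) \<le> c * ln (1 / \<tau>)"
    if \<tau>: "0 < \<tau>" "\<tau> < exp (- 1)" for \<tau>
  proof -
    have l: "1 \<le> ln (1 / \<tau>)"
      using \<tau> ln_less_cancel_iff[of \<tau> "exp (- 1)"] by (simp add: ln_div)
    have "the_enat (scheme_iters m \<sigma> \<tau> \<Delta> M q) = nat \<lceil>log r (B * \<tau>)\<rceil>"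
      using assms scheme_iters_eq_log[OF assms(1-3)] by (simp add: r_def B_def mult_ac)
    also have "log r (B * \<tau>) = ln B / ln r - 1 / ln r * ln (1 / \<tau>)"
      using B \<tau> by (simp add: log_def ln_mult ln_div add_divide_distrib)
    finally have "1 + real (the_enat (scheme_iters m \<sigma> \<tau> \<Delta> M q))
        \<le> 2 + \<bar>ln B / ln r\<bar> + \<bar>1 / ln r * ln (1 / \<tau>)\<bar>"
      by linarith
    also have "\<dots> \<le> (2 + \<bar>ln B / ln r\<bar>) * ln (1 / \<tau>) + \<bar>1 / ln r\<bar> * ln (1 / \<tau>)"
      using l mult_left_mono[OF l, of "2 + \<bar>ln B / ln r\<bar>"] by (simp add: abs_mult)
    finally show ?thesis
      by (simp add: c_def distrib_right)
  qed
  have "0 \<le> c"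
    by (simp add: c_def)
  show ?thesis
  proof (rule bigoI)
    have "norm (1 + real (the_enat (scheme_iters m \<sigma> \<tau> \<Delta> M q))) \<le> c * norm (ln (1 / \<tau>))"
      if "\<tau> \<in> {0<..<exp (- 1)}" for \<tau>
    proof -
      have "c * ln (1 / \<tau>) \<le> c * norm (ln (1 / \<tau>))"
        using \<open>0 \<le> c\<close> by (intro mult_left_mono) auto
      then show ?thesis
        using bound[of \<tau>] that by simp
    qed
    then show "\<forall>\<^sub>F \<tau> in at_right 0. norm (1 + real (the_enat (scheme_iters m \<sigma> \<tau> \<Delta> M q)))
        \<le> c * norm (ln (1 / \<tau>))"
      by (intro eventually_at_rightI[of 0 "exp (- 1)"]) auto
  qed
qed

section \<open>Iteration complexity of the bilevel algorithms\<close>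

theorem mainTheorem4:
  fixes C :: "(real^'d) set"
    and E :: "(real^'d) \<times> (real^'d) \<Rightarrow> real"
    and \<Phi> :: "(real^'d) \<times> (real^'d) \<Rightarrow> real^'d"
    and f qc :: "real^'d \<Rightarrow> real"
    and q M L \<rho> \<sigma> :: real
    and m :: hypergrad_scheme
    and alg :: fw_alg
    and a :: "nat \<Rightarrow> real^'d" and p :: nat
    and x0 :: "real^'d"
  defines "T \<equiv> (\<lambda>\<tau>. scheme_iters m \<sigma> \<tau> (diameter C) M q)"
  defines "G \<equiv> (\<lambda>\<tau>. hypergrad_est m E \<Phi> (T \<tau>))"
  defines "Nbar \<equiv> iter_bound alg C f L \<rho> \<sigma> x0"
  assumes "C \<noteq> {}" "compact C" "convex C" "diameter C > 0"
    and "lipschitz_C1_on E (UNIV \<times> C)" "lipschitz_C1_on \<Phi> (UNIV \<times> C)"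
    and "\<And>x. x \<in> C \<Longrightarrow> 0 < qc x \<and> qc x < 1 \<and> (qc x)-lipschitz_on UNIV (\<lambda>v. \<Phi> (v, x))"
    and "q \<in> qc ` C" "\<And>x. x \<in> C \<Longrightarrow> qc x \<le> q" "q < 1"
    and "\<And>x. x \<in> C \<Longrightarrow> f x = E (lower_sol \<Phi> x, x)"
    and "\<And>x. GDERIV f x :> grad f x" "L > 0" "L-lipschitz_on UNIV (grad f)"
    and "M > 0" "hypergrad_error_const C E \<Phi> f qc M"
    and "0 \<le> \<sigma>" "\<sigma> < 1 / 3" "\<rho> > 0"
    and "\<And>\<epsilon>. m = ITD \<epsilon> \<Longrightarrow> 0 < \<epsilon> \<and> \<epsilon> < 1"
    and "alg \<noteq> Vanilla \<Longrightarrow> C = convex hull (a ` {0..p})"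
  shows "(\<forall>\<tau>>0.
            (\<forall>S s. fw_run alg C a p f L \<rho> (G \<tau>) \<tau> x0 S s \<longrightarrow>
               (\<exists>N. fw_terminates_at (G \<tau>) \<tau> S s N \<and>
                    N \<le> nat (Nbar \<tau>) \<and>
                    (\<Sum>n=1..N. T \<tau>) \<le> enat (nat (Nbar \<tau>)) * T \<tau> \<and>
                    (\<Sum>n=0..N. T \<tau>) \<le> enat (nat (Nbar \<tau>) + 1) * T \<tau> \<and>
                    best_gap C f S N \<le> \<tau> / (1 + \<sigma>) * (1 + 2 * \<sigma>))) \<and>
            (\<forall>S s N. fw_performs alg C a p f L \<rho> (G \<tau>) x0 S s N \<and> int N \<ge> Nbar \<tau> \<longrightarrow>
               best_gap C f S N \<le> \<tau> / (1 + \<sigma>))) \<and>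
         (\<sigma> > 0 \<longrightarrow>
            (\<lambda>\<tau>. real_of_int (Nbar \<tau>) * real (the_enat (T \<tau>)))
              \<in> O[at_right 0](\<lambda>\<tau>. ln (1 / \<tau>) / \<tau>\<^sup>2) \<and>
            (\<exists>B :: real \<Rightarrow> nat. (\<lambda>\<tau>. real (B \<tau>)) \<in> O[at_right 0](\<lambda>\<tau>. ln (1 / \<tau>) / \<tau>\<^sup>2) \<and>
               (\<forall>\<tau>>0. \<forall>S s N. fw_run alg C a p f L \<rho> (G \<tau>) \<tau> x0 S s \<and>
                    fw_terminates_at (G \<tau>) \<tau> S s N \<longrightarrow>
                  (\<Sum>n=0..N. 1 + T \<tau>) \<le> enat (B \<tau>))))"
proof -
  have q: "0 < q"
    using assms by auto
  have err: "norm (G \<tau> x - grad f x) * diameter C \<le> \<sigma> / (1 + \<sigma>) * \<tau>"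
    if "0 < \<tau>" "x \<in> C" for \<tau> x
    unfolding G_def T_def using assms that by (intro hypergrad_est_error[where C = C and qc = qc]) auto
  have hull: "alg \<noteq> Vanilla \<Longrightarrow> C = convex hull (a ` {0..p})"
    by fact
  have run: "\<exists>N. fw_terminates_at (G \<tau>) \<tau> S s N \<and> N \<le> nat (Nbar \<tau>) \<and>
      best_gap C f S N \<le> \<tau> / (1 + \<sigma>) * (1 + 2 * \<sigma>)"
    if "0 < \<tau>" "fw_run alg C a p f L \<rho> (G \<tau>) \<tau> x0 S s" for \<tau> S s
    unfolding Nbar_def
    by (rule fw_run_terminates[OF \<open>compact C\<close> \<open>convex C\<close> hull \<open>0 < diameter C\<close> \<open>\<And>x. GDERIV f x :> grad f x\<close>
        \<open>L-lipschitz_on UNIV (grad f)\<close> \<open>0 < L\<close> \<open>0 < \<rho>\<close> \<open>0 \<le> \<sigma>\<close> \<open>\<sigma> < 1 / 3\<close> that(1) err[OF that(1)] that(2)])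
  have performs: "best_gap C f S N \<le> \<tau> / (1 + \<sigma>)"
    if "0 < \<tau>" "fw_performs alg C a p f L \<rho> (G \<tau>) x0 S s N" "Nbar \<tau> \<le> int N" for \<tau> S s N
    by (rule fw_performs_best_gap[OF \<open>compact C\<close> \<open>convex C\<close> hull \<open>0 < diameter C\<close> \<open>\<And>x. GDERIV f x :> grad f x\<close>
        \<open>L-lipschitz_on UNIV (grad f)\<close> \<open>0 < L\<close> \<open>0 < \<rho>\<close> \<open>0 \<le> \<sigma>\<close> \<open>\<sigma> < 1 / 3\<close> that(1) err[OF that(1)] that(2) that(3)[unfolded Nbar_def]])
  have sums: "(\<Sum>n=1..N. t) \<le> enat K * t" "(\<Sum>n=0..N. t) \<le> enat (K + 1) * t"
    if "N \<le> K" for N K and t :: enat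
    using that by (simp_all add: of_nat_eq_enat mult_right_mono)
  have orders: "(\<lambda>\<tau>. 1 + \<bar>real_of_int (Nbar \<tau>)\<bar>) \<in> O[at_right 0](\<lambda>\<tau>. 1 / \<tau>\<^sup>2)"
    "(\<lambda>\<tau>. 1 + real (the_enat (T \<tau>))) \<in> O[at_right 0](\<lambda>\<tau>. ln (1 / \<tau>))" if "0 < \<sigma>"
    unfolding Nbar_def T_def
    using assms q that by (auto intro!: iter_bound_bigo scheme_iters_bigo)
  have prod: "(\<lambda>\<tau>. (1 + \<bar>real_of_int (Nbar \<tau>)\<bar>) * (1 + real (the_enat (T \<tau>))))
      \<in> O[at_right 0](\<lambda>\<tau>. ln (1 / \<tau>) / \<tau>\<^sup>2)" if "0 < \<sigma>"
    using landau_o.big.mult[OF orders[OF that]] by simp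
  define B where "B = (\<lambda>\<tau>. (nat (Nbar \<tau>) + 1) * (1 + the_enat (T \<tau>)))"
  have "(\<lambda>\<tau>. real_of_int (Nbar \<tau>) * real (the_enat (T \<tau>))) \<in> O[at_right 0](\<lambda>\<tau>. ln (1 / \<tau>) / \<tau>\<^sup>2)"
    if "0 < \<sigma>"
    by (rule landau_o.big_trans[OF landau_o.big_mono prod[OF that]])
      (auto simp: abs_mult intro!: always_eventually mult_mono)
  moreover have "real (B \<tau>) \<le> (1 + \<bar>real_of_int (Nbar \<tau>)\<bar>) * (1 + real (the_enat (T \<tau>)))" for \<tau>
    unfolding B_def of_nat_mult by (intro mult_mono) auto
  then have "(\<lambda>\<tau>. real (B \<tau>)) \<in> O[at_right 0](\<lambda>\<tau>. ln (1 / \<tau>) / \<tau>\<^sup>2)" if "0 < \<sigma>"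
    by (intro landau_o.big_trans[OF landau_o.big_mono prod[OF that]] always_eventually)
      (simp add: abs_mult)
  moreover have "(\<Sum>n=0..N. 1 + T \<tau>) \<le> enat (B \<tau>)"
    if "0 < \<sigma>" and \<tau>: "0 < \<tau>" and r: "fw_run alg C a p f L \<rho> (G \<tau>) \<tau> x0 S s"
      and N: "fw_terminates_at (G \<tau>) \<tau> S s N"
    for \<tau> S s N
  proof -
    obtain N' where N': "fw_terminates_at (G \<tau>) \<tau> S s N'" "N' \<le> nat (Nbar \<tau>)"
      using run[OF \<tau> r] by blast
    have "N = N'"
      using N N'(1) unfolding fw_terminates_at_def by (metis linorder_neqE_nat)
    then have "(\<Sum>n=0..N. 1 + T \<tau>) \<le> enat (nat (Nbar \<tau>) + 1) * (1 + T \<tau>)"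
      using sums(2) N'(2) by blast
    moreover obtain t where "T \<tau> = enat t"
      using \<open>0 < \<sigma>\<close> by (simp add: T_def scheme_iters_def)
    ultimately show ?thesis
      by (simp only: B_def the_enat.simps one_enat_def plus_enat_simps times_enat_simps)
  qed
  ultimately show ?thesis
    using run performs sums by meson
qed

end
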